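(* Let $0\neq\lambda\in kG$ have no constant term, and let $\Delta_\alpha$ and $\Delta_{\alpha'}$, $\alpha\neq\alpha'$ in $k$, be distinct Verma modules over $H_\lambda$. Then for all simple modules $S_{\alpha,\beta}$, $S_{\alpha',\beta'}$ obtained as quotients or subquotients of $\Delta_\alpha$ and $\Delta_{\alpha'}$ respectively, and for all $i\ge0$, $$\operatorname{Ext}^i_{H_\lambda}(S_{\alpha,\beta},S_{\alpha',\beta'})=0.$$
   Context: Let $p$ be an odd prime, $k$ an algebraically closed field of characteristic $p$, and $G=\langle g\rangle$ the cyclic group of order $p$ generated by $g=\begin{pmatrix}1&1\\0&1\end{pmatrix}\in \mathrm{SL}(2,p)$. $G$ acts on the free algebra $k\langle x,y\rangle$ by algebra automorphisms with $g\cdot x=x$, $g\cdot y=x+y$, and $k\langle x,y\rangle\rtimes G$ is the smash product (so $gf=(g\cdot f)g$). For $\lambda\in kG$ set $H_\lambda=(k\langle x,y\rangle\rtimes G)/(xy-yx-\lambda)$. The constant term of $\lambda=\sum c_ig^i$ is $c_0$. Modules are left modules. Verma modules: $\Delta_\alpha=H_\lambda/(H_\lambda(x-\alpha)+H_\lambda(g-1))$ for $\alpha\in k$. *)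

theory Defs
  imports
    "HOL-Library.Poly_Mapping"
    "HOL-Computational_Algebra.Computational_Algebra"
    "HOL-Algebra.Module"
    "HOL-Algebra.QuotRing"
    "HOL-Algebra.Elementary_Groups"
begin

section \<open>The algebra \<open>H\<^sub>\<lambda>\<close>\<close>

subsection \<open>The free algebra on two generators\<close>

datatype letter = LX | LY

datatype word = Word (letters: "letter list")

instantiation word :: monoid_add
begin

definition zero_word :: word where "0 = Word []"

definition plus_word :: "word \<Rightarrow> word \<Rightarrow> word" where
  "u + v = Word (letters u @ letters v)"

instance by standard (simp_all add: zero_word_def plus_word_def)

end

text \<open>The free monoid on two letters is written additively, so that \<^typ>\<open>word \<Rightarrow>\<^sub>0 'k\<close> with the
  convolution product of \<^theory>\<open>HOL-Library.Poly_Mapping\<close> is its monoid algebra, i.e. the free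
  algebra \<open>k\<langle>x,y\<rangle>\<close>; the scalar \<open>c\<close> is \<open>Poly_Mapping.single 0 c\<close>.\<close>

type_synonym 'k free_alg = "word \<Rightarrow>\<^sub>0 'k"

definition fa_x :: "'k::field free_alg" where "fa_x = Poly_Mapping.single (Word [LX]) 1"

definition fa_y :: "'k::field free_alg" where "fa_y = Poly_Mapping.single (Word [LY]) 1"

subsection \<open>The action of the generator \<open>g\<close>\<close>

fun g_letter :: "letter \<Rightarrow> 'k::field free_alg" where
  "g_letter LX = fa_x"
| "g_letter LY = fa_x + fa_y"

definition g_act :: "'k::field free_alg \<Rightarrow> 'k free_alg" where
  "g_act f = (\<Sum>w\<in>Poly_Mapping.keys f.
     Poly_Mapping.single 0 (Poly_Mapping.lookup f w) * prod_list (map g_letter (letters w)))"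

subsection \<open>The smash product\<close>

text \<open>An element \<open>\<Sum>\<^sub>i f\<^sub>i g\<^sup>i\<close> (\<open>0 \<le> i < p\<close>, \<open>f\<^sub>i \<in> k\<langle>x,y\<rangle>\<close>) is the function \<open>i \<mapsto> f\<^sub>i\<close>, which is
  \<open>0\<close> outside \<open>{..<p}\<close>; the product is \<open>(f g\<^sup>i) (f' g\<^sup>j) = f (g\<^sup>i \<cdot> f') g\<^sup>i\<^sup>+\<^sup>j\<close>, exponents modulo \<open>p\<close>.
  Associativity needs \<open>g\<close> to act with order dividing \<open>p\<close>, which holds when \<open>k\<close> has
  characteristic \<open>p\<close>.\<close>

definition smash :: "nat \<Rightarrow> (nat \<Rightarrow> 'k::field free_alg) ring" where
  "smash p =
     \<lparr>carrier = {a. \<forall>i\<ge>p. a i = 0},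
      mult = (\<lambda>a b n. if n < p
                then \<Sum>i<p. \<Sum>j<p. if (i + j) mod p = n then a i * (g_act ^^ i) (b j) else 0
                else 0),
      one = (\<lambda>i. if i = 0 then 1 else 0),
      zero = (\<lambda>i. 0),
      add = (\<lambda>a b i. a i + b i)\<rparr>"

definition of_free_alg :: "'k::field free_alg \<Rightarrow> nat \<Rightarrow> 'k free_alg" where
  "of_free_alg f = (\<lambda>i. if i = 0 then f else 0)"

definition smash_g :: "nat \<Rightarrow> 'k::field free_alg" where
  "smash_g = (\<lambda>i. if i = 1 then 1 else 0)"

text \<open>An element \<open>\<Sum>\<^sub>i c\<^sub>i g\<^sup>i\<close> of \<open>kG\<close> is the function \<open>i \<mapsto> c\<^sub>i\<close> of its coefficients; in particular
  its constant term is its value at \<open>0\<close>.\<close>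

definition group_alg :: "nat \<Rightarrow> (nat \<Rightarrow> 'k::field) set" where
  "group_alg p = {c. \<forall>i\<ge>p. c i = 0}"

definition of_group_alg :: "(nat \<Rightarrow> 'k::field) \<Rightarrow> nat \<Rightarrow> 'k free_alg" where
  "of_group_alg c = (\<lambda>i. Poly_Mapping.single 0 (c i))"

subsection \<open>The quotient algebra\<close>

definition H_rel_ideal :: "nat \<Rightarrow> (nat \<Rightarrow> 'k::field) \<Rightarrow> (nat \<Rightarrow> 'k free_alg) set" where
  "H_rel_ideal p l = Idl\<^bsub>smash p\<^esub>
     {of_free_alg (fa_x * fa_y - fa_y * fa_x) \<ominus>\<^bsub>smash p\<^esub> of_group_alg l}"

type_synonym 'k H_elem = "(nat \<Rightarrow> 'k free_alg) set"

definition H_alg :: "nat \<Rightarrow> (nat \<Rightarrow> 'k::field) \<Rightarrow> 'k H_elem ring" where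
  "H_alg p l = smash p Quot H_rel_ideal p l"

definition H_proj :: "nat \<Rightarrow> (nat \<Rightarrow> 'k::field) \<Rightarrow> (nat \<Rightarrow> 'k free_alg) \<Rightarrow> 'k H_elem" where
  "H_proj p l a = H_rel_ideal p l +>\<^bsub>smash p\<^esub> a"


section \<open>Left modules over a not necessarily commutative ring\<close>

text \<open>Modules are represented by the library's record type for modules, whose ring
  multiplication and unit are ignored; the library's locale requires a commutative ring.\<close>

locale left_module = R?: ring R + M?: abelian_group M
  for R :: "('r, 's) ring_scheme" (structure)
    and M :: "('r, 'm, 't) module_scheme" (structure) +
  assumes smult_closed:
      "\<lbrakk>a \<in> carrier R; x \<in> carrier M\<rbrakk> \<Longrightarrow> a \<odot>\<^bsub>M\<^esub> x \<in> carrier M"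
    and smult_l_distr:
      "\<lbrakk>a \<in> carrier R; b \<in> carrier R; x \<in> carrier M\<rbrakk> \<Longrightarrow>
       (a \<oplus>\<^bsub>R\<^esub> b) \<odot>\<^bsub>M\<^esub> x = (a \<odot>\<^bsub>M\<^esub> x) \<oplus>\<^bsub>M\<^esub> (b \<odot>\<^bsub>M\<^esub> x)"
    and smult_r_distr:
      "\<lbrakk>a \<in> carrier R; x \<in> carrier M; y \<in> carrier M\<rbrakk> \<Longrightarrow>
       a \<odot>\<^bsub>M\<^esub> (x \<oplus>\<^bsub>M\<^esub> y) = (a \<odot>\<^bsub>M\<^esub> x) \<oplus>\<^bsub>M\<^esub> (a \<odot>\<^bsub>M\<^esub> y)"
    and smult_assoc:
      "\<lbrakk>a \<in> carrier R; b \<in> carrier R; x \<in> carrier M\<rbrakk> \<Longrightarrow>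
       (a \<otimes>\<^bsub>R\<^esub> b) \<odot>\<^bsub>M\<^esub> x = a \<odot>\<^bsub>M\<^esub> (b \<odot>\<^bsub>M\<^esub> x)"
    and smult_one: "x \<in> carrier M \<Longrightarrow> \<one>\<^bsub>R\<^esub> \<odot>\<^bsub>M\<^esub> x = x"

definition module_hom ::
    "('r, 's) ring_scheme \<Rightarrow> ('r, 'a) module \<Rightarrow> ('r, 'b) module \<Rightarrow> ('a \<Rightarrow> 'b) set" where
  "module_hom R M N = {f \<in> carrier M \<rightarrow> carrier N.
     (\<forall>x\<in>carrier M. \<forall>y\<in>carrier M. f (x \<oplus>\<^bsub>M\<^esub> y) = f x \<oplus>\<^bsub>N\<^esub> f y) \<and>
     (\<forall>a\<in>carrier R. \<forall>x\<in>carrier M. f (a \<odot>\<^bsub>M\<^esub> x) = a \<odot>\<^bsub>N\<^esub> f x)}"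

definition module_isomorphic ::
    "('r, 's) ring_scheme \<Rightarrow> ('r, 'a) module \<Rightarrow> ('r, 'b) module \<Rightarrow> bool" where
  "module_isomorphic R M N \<longleftrightarrow>
     (\<exists>f\<in>module_hom R M N. bij_betw f (carrier M) (carrier N))"

definition simple_module :: "('r, 's) ring_scheme \<Rightarrow> ('r, 'a) module \<Rightarrow> bool" where
  "simple_module R M \<longleftrightarrow> left_module R M \<and> carrier M \<noteq> {\<zero>\<^bsub>M\<^esub>} \<and>
     (\<forall>N. submodule N R M \<longrightarrow> N = {\<zero>\<^bsub>M\<^esub>} \<or> N = carrier M)"

definition regular_module :: "('r, 's) ring_scheme \<Rightarrow> ('r, 'r) module" where
  "regular_module R = \<lparr>carrier = carrier R, mult = mult R, one = one R,
     zero = zero R, add = add R, smult = mult R\<rparr>"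

definition quotient_module :: "('r, 'a) module \<Rightarrow> 'a set \<Rightarrow> ('r, 'a set) module" where
  "quotient_module M N = \<lparr>carrier = a_rcosets\<^bsub>M\<^esub> N, mult = undefined, one = undefined,
     zero = N, add = set_add M,
     smult = (\<lambda>a C. \<Union>x\<in>C. N +>\<^bsub>M\<^esub> (a \<odot>\<^bsub>M\<^esub> x))\<rparr>"

text \<open>\<open>S\<close> is isomorphic to \<open>A / B\<close> for submodules \<open>B \<subseteq> A\<close> of \<open>M\<close>. Quotients of \<open>M\<close> are the
  case that \<open>A\<close> is all of \<open>M\<close>.\<close>

definition is_subquotient ::
    "('r, 's) ring_scheme \<Rightarrow> ('r, 'a) module \<Rightarrow> ('r, 'b) module \<Rightarrow> bool" where
  "is_subquotient R S M \<longleftrightarrow>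
     (\<exists>A B. submodule A R M \<and> submodule B R M \<and> B \<subseteq> A \<and>
            module_isomorphic R S (quotient_module (M\<lparr>carrier := A\<rparr>) B))"


section \<open>Verma modules\<close>

definition verma :: "nat \<Rightarrow> (nat \<Rightarrow> 'k::field) \<Rightarrow> 'k \<Rightarrow> ('k H_elem, 'k H_elem set) module" where
  "verma p l \<alpha> = (let H = H_alg p l;
       u = H_proj p l (of_free_alg (fa_x - Poly_Mapping.single 0 \<alpha>));
       v = H_proj p l smash_g \<ominus>\<^bsub>H\<^esub> \<one>\<^bsub>H\<^esub>
     in quotient_module (regular_module H)
          {a \<otimes>\<^bsub>H\<^esub> u \<oplus>\<^bsub>H\<^esub> b \<otimes>\<^bsub>H\<^esub> v | a b. a \<in> carrier H \<and> b \<in> carrier H})"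


section \<open>Ext groups\<close>

text \<open>The lifting property is stated for modules over the types \<^typ>\<open>'c \<Rightarrow> 'r\<close> and \<^typ>\<open>'c\<close>. This
  is no loss: \<^typ>\<open>'c \<Rightarrow> 'r\<close> accommodates the free module on the carrier of \<open>P\<close>, and lifting the
  identity of \<open>P\<close> along its canonical surjection onto \<open>P\<close> makes \<open>P\<close> a direct summand of a free
  module.\<close>

definition projective_module :: "('r, 's) ring_scheme \<Rightarrow> ('r, 'c) module \<Rightarrow> bool" where
  "projective_module R P \<longleftrightarrow> left_module R P \<and>
     (\<forall>(A :: ('r, 'c \<Rightarrow> 'r) module) (B :: ('r, 'c) module). \<forall>f\<in>module_hom R A B. \<forall>h\<in>module_hom R P B.
        left_module R A \<and> left_module R B \<and> f ` carrier A = carrier B \<longrightarrow>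
        (\<exists>h'\<in>module_hom R P A. \<forall>x\<in>carrier P. f (h' x) = h x))"

text \<open>\<open>\<dots> \<rightarrow> P\<^sub>2 \<rightarrow> P\<^sub>1 \<rightarrow> P\<^sub>0 \<rightarrow> M \<rightarrow> 0\<close> with differentials \<open>d n : P\<^sub>n\<^sub>+\<^sub>1 \<rightarrow> P\<^sub>n\<close> and augmentation \<open>\<epsilon>\<close>.\<close>

definition projective_resolution ::
    "('r, 's) ring_scheme \<Rightarrow> ('r, 'a) module \<Rightarrow> (nat \<Rightarrow> ('r, 'c) module) \<Rightarrow>
     (nat \<Rightarrow> 'c \<Rightarrow> 'c) \<Rightarrow> ('c \<Rightarrow> 'a) \<Rightarrow> bool" where
  "projective_resolution R M P d \<epsilon> \<longleftrightarrow>
     left_module R M \<and>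
     (\<forall>n. projective_module R (P n)) \<and>
     (\<forall>n. d n \<in> module_hom R (P (Suc n)) (P n)) \<and>
     \<epsilon> \<in> module_hom R (P 0) M \<and>
     \<epsilon> ` carrier (P 0) = carrier M \<and>
     d 0 ` carrier (P 1) = a_kernel (P 0) M \<epsilon> \<and>
     (\<forall>n. d (Suc n) ` carrier (P (Suc (Suc n))) = a_kernel (P (Suc n)) (P n) (d n))"

definition hom_group ::
    "('r, 's) ring_scheme \<Rightarrow> ('r, 'a) module \<Rightarrow> ('r, 'b) module \<Rightarrow> ('a \<Rightarrow> 'b) monoid" where
  "hom_group R M N =
     \<lparr>carrier = module_hom R M N \<inter> extensional (carrier M),
      mult = (\<lambda>f g. \<lambda>x\<in>carrier M. f x \<oplus>\<^bsub>N\<^esub> g x),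
      one = (\<lambda>x\<in>carrier M. \<zero>\<^bsub>N\<^esub>)\<rparr>"

text \<open>The map \<open>Hom(P\<^sub>n, N) \<rightarrow> Hom(P\<^sub>n\<^sub>+\<^sub>1, N)\<close> given by precomposition with \<open>d n\<close>.\<close>

definition hom_diff ::
    "(nat \<Rightarrow> ('r, 'c) module) \<Rightarrow> (nat \<Rightarrow> 'c \<Rightarrow> 'c) \<Rightarrow> nat \<Rightarrow> ('c \<Rightarrow> 'b) \<Rightarrow> 'c \<Rightarrow> 'b" where
  "hom_diff P d n f = compose (carrier (P (Suc n))) f (d n)"

definition cocycles ::
    "('r, 's) ring_scheme \<Rightarrow> (nat \<Rightarrow> ('r, 'c) module) \<Rightarrow> (nat \<Rightarrow> 'c \<Rightarrow> 'c) \<Rightarrow>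
     ('r, 'b) module \<Rightarrow> nat \<Rightarrow> ('c \<Rightarrow> 'b) set" where
  "cocycles R P d N n =
     kernel (hom_group R (P n) N) (hom_group R (P (Suc n)) N) (hom_diff P d n)"

fun coboundaries ::
    "('r, 's) ring_scheme \<Rightarrow> (nat \<Rightarrow> ('r, 'c) module) \<Rightarrow> (nat \<Rightarrow> 'c \<Rightarrow> 'c) \<Rightarrow>
     ('r, 'b) module \<Rightarrow> nat \<Rightarrow> ('c \<Rightarrow> 'b) set" where
  "coboundaries R P d N 0 = {\<one>\<^bsub>hom_group R (P 0) N\<^esub>}"
| "coboundaries R P d N (Suc n) = hom_diff P d n ` carrier (hom_group R (P n) N)"

text \<open>The \<open>n\<close>-th cohomology group of \<open>Hom\<^sub>R(P\<^sub>\<bullet>, N)\<close>. When \<open>P\<close>, \<open>d\<close> is a projective resolution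
  of \<open>M\<close>, this is \<open>Ext\<^sup>n\<^sub>R(M, N)\<close>.\<close>

definition Ext_group ::
    "('r, 's) ring_scheme \<Rightarrow> (nat \<Rightarrow> ('r, 'c) module) \<Rightarrow> (nat \<Rightarrow> 'c \<Rightarrow> 'c) \<Rightarrow>
     ('r, 'b) module \<Rightarrow> nat \<Rightarrow> ('c \<Rightarrow> 'b) set monoid" where
  "Ext_group R P d N n =
     (hom_group R (P n) N\<lparr>carrier := cocycles R P d N n\<rparr>) Mod coboundaries R P d N n"

end

theory Submission
  imports Defs
begin

text \<open>Since \<open>\<lambda>\<close> commutes with \<open>x\<close>, the relation \<open>xy - yx = \<lambda>\<close> gives \<open>x\<^sup>ny - yx\<^sup>n = n x\<^sup>n\<^sup>-\<^sup>1 \<lambda>\<close>, so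
  \<open>x\<^sup>p\<close> is central in \<open>H\<^sub>\<lambda>\<close>. It acts on \<open>\<Delta>\<^sub>\<alpha>\<close>, hence on all subquotients, as the scalar \<open>\<alpha>\<^sup>p\<close>, and
  \<open>\<alpha>\<^sup>p \<noteq> \<alpha>'\<^sup>p\<close> because the Frobenius map is injective. So the central element \<open>x\<^sup>p - \<alpha>\<^sup>p\<close> acts on
  \<open>Ext(S, S')\<close> both as zero, through \<open>S\<close>, and invertibly, through \<open>S'\<close>.\<close>

section \<open>Modules and the vanishing of Ext\<close>

text \<open>The statement quantifies over every projective resolution \<open>P\<close> of
  \<open>S\<close>, and no functoriality of Ext is set up, so the two actions are compared on
  cochains. Write z = x^p - \<alpha>^p. Lifting against projectives gives a homotopy t, and every
  cocycle f of positive degree then satisfies z f = f t d. On \<open>S'\<close> the element x^p acts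
  as \<alpha>'^p, hence z as the nonzero scalar \<alpha>'^p - \<alpha>^p; with w the inverse of this
  scalar, f = (w f t) d is a coboundary. Centrality of z and w is what makes multiplication by them
  a module homomorphism.

  Commuting with x and y does not yet make z central: it must also commute with g. This holds
  because g fixes x, and the terms f_k g^k of an element can then be treated one at a time.\<close>

lemma (in left_module) smult_l_zero:
  assumes x: "x \<in> carrier M"
  shows "\<zero>\<^bsub>R\<^esub> \<odot>\<^bsub>M\<^esub> x = \<zero>\<^bsub>M\<^esub>"
proof -
  have "\<zero>\<^bsub>R\<^esub> \<odot>\<^bsub>M\<^esub> x \<oplus>\<^bsub>M\<^esub> \<zero>\<^bsub>R\<^esub> \<odot>\<^bsub>M\<^esub> x = \<zero>\<^bsub>R\<^esub> \<odot>\<^bsub>M\<^esub> x"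
    using smult_l_distr[OF R.zero_closed R.zero_closed x] by simp
  then show ?thesis
    using smult_closed[OF R.zero_closed x] by (metis M.add.r_cancel_one')
qed

lemma (in left_module) smult_r_zero:
  assumes a: "a \<in> carrier R"
  shows "a \<odot>\<^bsub>M\<^esub> \<zero>\<^bsub>M\<^esub> = \<zero>\<^bsub>M\<^esub>"
proof -
  have "a \<odot>\<^bsub>M\<^esub> \<zero>\<^bsub>M\<^esub> \<oplus>\<^bsub>M\<^esub> a \<odot>\<^bsub>M\<^esub> \<zero>\<^bsub>M\<^esub> = a \<odot>\<^bsub>M\<^esub> \<zero>\<^bsub>M\<^esub>"
    using smult_r_distr[OF a M.zero_closed M.zero_closed] by simp
  then show ?thesis
    using smult_closed[OF a M.zero_closed] by (metis M.add.r_cancel_one')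
qed

lemma (in left_module) smult_minus_one:
  assumes x: "x \<in> carrier M"
  shows "(\<ominus>\<^bsub>R\<^esub> \<one>\<^bsub>R\<^esub>) \<odot>\<^bsub>M\<^esub> x = \<ominus>\<^bsub>M\<^esub> x"
proof -
  have "(\<ominus>\<^bsub>R\<^esub> \<one>\<^bsub>R\<^esub>) \<odot>\<^bsub>M\<^esub> x \<oplus>\<^bsub>M\<^esub> x = (\<ominus>\<^bsub>R\<^esub> \<one>\<^bsub>R\<^esub> \<oplus>\<^bsub>R\<^esub> \<one>\<^bsub>R\<^esub>) \<odot>\<^bsub>M\<^esub> x"
    using smult_l_distr[of "\<ominus>\<^bsub>R\<^esub> \<one>\<^bsub>R\<^esub>" "\<one>\<^bsub>R\<^esub>" x] x smult_one by simp
  also have "\<dots> = \<zero>\<^bsub>M\<^esub>"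
    using x smult_l_zero by (simp add: R.l_neg)
  finally show ?thesis
    using x smult_closed by (metis M.minus_equality R.a_inv_closed R.one_closed)
qed

lemma (in left_module) smult_r_minus:
  assumes a: "a \<in> carrier R" and x: "x \<in> carrier M"
  shows "a \<odot>\<^bsub>M\<^esub> (\<ominus>\<^bsub>M\<^esub> x) = \<ominus>\<^bsub>M\<^esub> (a \<odot>\<^bsub>M\<^esub> x)"
proof -
  have "a \<odot>\<^bsub>M\<^esub> (\<ominus>\<^bsub>M\<^esub> x) \<oplus>\<^bsub>M\<^esub> a \<odot>\<^bsub>M\<^esub> x = a \<odot>\<^bsub>M\<^esub> (\<ominus>\<^bsub>M\<^esub> x \<oplus>\<^bsub>M\<^esub> x)"
    using a x by (simp add: smult_r_distr)
  also have "\<dots> = \<zero>\<^bsub>M\<^esub>"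
    using a x smult_r_zero by (simp add: M.l_neg)
  finally show ?thesis
    using a x smult_closed by (metis M.minus_equality M.a_inv_closed)
qed

section \<open>Homomorphisms of left modules, and lifting along them\<close>

lemma module_homD:
  assumes "f \<in> module_hom R M N"
  shows "x \<in> carrier M \<Longrightarrow> f x \<in> carrier N"
    and "x \<in> carrier M \<Longrightarrow> y \<in> carrier M \<Longrightarrow> f (x \<oplus>\<^bsub>M\<^esub> y) = f x \<oplus>\<^bsub>N\<^esub> f y"
    and "a \<in> carrier R \<Longrightarrow> x \<in> carrier M \<Longrightarrow> f (a \<odot>\<^bsub>M\<^esub> x) = a \<odot>\<^bsub>N\<^esub> f x"
  using assms by (auto simp: module_hom_def)

lemma module_homI:
  assumes "\<And>x. x \<in> carrier M \<Longrightarrow> f x \<in> carrier N"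
    and "\<And>x y. x \<in> carrier M \<Longrightarrow> y \<in> carrier M \<Longrightarrow> f (x \<oplus>\<^bsub>M\<^esub> y) = f x \<oplus>\<^bsub>N\<^esub> f y"
    and "\<And>a x. a \<in> carrier R \<Longrightarrow> x \<in> carrier M \<Longrightarrow> f (a \<odot>\<^bsub>M\<^esub> x) = a \<odot>\<^bsub>N\<^esub> f x"
  shows "f \<in> module_hom R M N"
  using assms by (auto simp: module_hom_def)

lemma module_hom_zero:
  assumes "left_module R M" "left_module R N" "f \<in> module_hom R M N"
  shows "f \<zero>\<^bsub>M\<^esub> = \<zero>\<^bsub>N\<^esub>"
proof -
  interpret M: left_module R M by fact
  interpret N: left_module R N by fact
  have "f \<zero>\<^bsub>M\<^esub> = f (\<zero>\<^bsub>R\<^esub> \<odot>\<^bsub>M\<^esub> \<zero>\<^bsub>M\<^esub>)"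
    by (simp add: M.smult_l_zero)
  also have "\<dots> = \<zero>\<^bsub>N\<^esub>"
    using module_homD[OF assms(3)] by (simp add: N.smult_l_zero)
  finally show ?thesis .
qed

lemma module_hom_minus:
  assumes "left_module R M" "left_module R N" "f \<in> module_hom R M N" "x \<in> carrier M"
  shows "f (\<ominus>\<^bsub>M\<^esub> x) = \<ominus>\<^bsub>N\<^esub> f x"
proof -
  interpret M: left_module R M by fact
  interpret N: left_module R N by fact
  show ?thesis
    using module_homD[OF assms(3)] assms(4)
    by (simp flip: M.smult_minus_one N.smult_minus_one)
qed

lemma module_hom_comp:
  assumes "f \<in> module_hom R L M" "g \<in> module_hom R M N"
  shows "(\<lambda>x. g (f x)) \<in> module_hom R L N"
  using assms by (auto simp: module_hom_def Pi_iff)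

lemma module_hom_add:
  assumes "left_module R N" "f \<in> module_hom R M N" "g \<in> module_hom R M N"
  shows "(\<lambda>x. f x \<oplus>\<^bsub>N\<^esub> g x) \<in> module_hom R M N"
proof -
  interpret N: left_module R N by fact
  show ?thesis
    using module_homD[OF assms(2)] module_homD[OF assms(3)]
    by (intro module_homI) (auto simp: N.smult_r_distr N.add.m_ac)
qed

text \<open>Centrality lets \<open>z\<close> pass the scalar \<open>a\<close>; for a general
  \<open>z\<close> this map is additive but need not be \<open>R\<close>-linear.\<close>

lemma module_hom_central_smult:
  assumes "left_module R N" "f \<in> module_hom R M N"
    and "z \<in> carrier R" "\<And>a. a \<in> carrier R \<Longrightarrow> z \<otimes>\<^bsub>R\<^esub> a = a \<otimes>\<^bsub>R\<^esub> z"
  shows "(\<lambda>x. z \<odot>\<^bsub>N\<^esub> f x) \<in> module_hom R M N"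
proof -
  interpret N: left_module R N by fact
  show ?thesis
    using module_homD[OF assms(2)] assms(3,4)
    by (intro module_homI) (auto simp: N.smult_r_distr N.smult_closed simp flip: N.smult_assoc)
qed

lemma module_hom_uminus:
  assumes "left_module R N" "f \<in> module_hom R M N"
  shows "(\<lambda>x. \<ominus>\<^bsub>N\<^esub> f x) \<in> module_hom R M N"
proof -
  interpret N: left_module R N by fact
  show ?thesis
    using module_homD[OF assms(2)]
    by (intro module_homI) (auto simp: N.M.minus_add N.smult_r_minus)
qed

text \<open>The structure is carried to the image of \<open>j\<close>, where \<open>k\<close>
  inverts \<open>j\<close>, so \<open>k\<close> is an isomorphism back to \<open>M\<close>. The
  purpose is to place a module on the larger type over which projectivity is tested.\<close>

lemma left_module_transport:
  fixes j :: "'a \<Rightarrow> 'b" and M :: "('r, 'a) module"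
  assumes "left_module R M" and kj [simp]: "\<And>x. k (j x) = x"
  obtains N :: "('r, 'b) module" where "left_module R N"
    and "k \<in> module_hom R N M" and "k ` carrier N = carrier M"
proof -
  interpret M: left_module R M by fact
  define N :: "('r, 'b) module" where "N = \<lparr>carrier = j ` carrier M, mult = undefined,
    one = undefined, zero = j \<zero>\<^bsub>M\<^esub>, add = (\<lambda>x y. j (k x \<oplus>\<^bsub>M\<^esub> k y)),
    smult = (\<lambda>a x. j (a \<odot>\<^bsub>M\<^esub> k x))\<rparr>"
  have "abelian_group N"
  proof (rule abelian_groupI)
    fix x assume "x \<in> carrier N"
    then show "\<exists>y\<in>carrier N. y \<oplus>\<^bsub>N\<^esub> x = \<zero>\<^bsub>N\<^esub>"
      by (auto simp: N_def M.M.l_neg intro!: bexI[of _ "\<ominus>\<^bsub>M\<^esub> _"])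
  qed (auto simp: N_def M.M.a_ac)
  then have "left_module R N"
    by (intro left_module.intro left_module_axioms.intro M.R.ring_axioms)
       (auto simp: N_def M.smult_closed M.smult_l_distr M.smult_r_distr M.smult_assoc M.smult_one)
  moreover have "k \<in> module_hom R N M"
    by (auto simp: N_def module_hom_def M.smult_closed)
  moreover have "k ` carrier N = carrier M"
    by (auto simp: N_def image_image)
  ultimately show ?thesis using that by blast
qed

text \<open>Projectivity grants lifts along surjections, while the differentials of a resolution
  need not be surjective. They become so once the codomain shrinks to the image.\<close>

lemma left_module_image:
  assumes "left_module R A" "left_module R M" "f \<in> module_hom R A M"
  shows "left_module R (M\<lparr>carrier := f ` carrier A\<rparr>)"
proof -
  interpret A: left_module R A by fact
  interpret M: left_module R M by fact
  note f = module_homD[OF assms(3)]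
  let ?N = "M\<lparr>carrier := f ` carrier A\<rparr>"
  have "abelian_group ?N"
  proof (rule abelian_groupI)
    show "\<zero>\<^bsub>?N\<^esub> \<in> carrier ?N"
      using module_hom_zero[OF assms] by (auto intro!: image_eqI[of _ _ "\<zero>\<^bsub>A\<^esub>"])
  next
    fix x assume "x \<in> carrier ?N"
    then obtain a where "a \<in> carrier A" "x = f a" by auto
    then show "\<exists>y\<in>carrier ?N. y \<oplus>\<^bsub>?N\<^esub> x = \<zero>\<^bsub>?N\<^esub>"
      using f by (auto simp: module_hom_minus[OF assms] M.M.l_neg intro!: bexI[of _ "\<ominus>\<^bsub>A\<^esub> a"])
  qed (auto simp: f A.M.a_ac M.M.a_ac simp flip: f(2))
  then show ?thesis
    by (intro left_module.intro left_module_axioms.intro A.R.ring_axioms)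
       (auto simp: f A.smult_closed A.smult_l_distr M.smult_r_distr A.smult_assoc A.smult_one
         simp flip: f(3))
qed

text \<open>\<^const>\<open>projective_module\<close> only lifts along maps out of modules over \<^typ>\<open>'c \<Rightarrow> 'r\<close>, so \<open>A\<close> is
  moved there along an injection, which exists once \<^typ>\<open>'r\<close> has two elements.\<close>

lemma projective_module_lift:
  fixes R :: "('r, 's) ring_scheme" and P A M :: "('r, 'c) module"
  assumes "projective_module R P" "left_module R A" "left_module R M"
    and "f \<in> module_hom R A M" "h \<in> module_hom R P M" "h ` carrier P \<subseteq> f ` carrier A"
    and "(u :: 'r) \<noteq> v"
  obtains h' where "h' \<in> module_hom R P A" "\<And>x. x \<in> carrier P \<Longrightarrow> f (h' x) = h x"
proof -
  \<comment> \<open>Each \<open>x\<close> is coded by the function taking the value \<open>u\<close>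
    at \<open>x\<close> alone, so distinct elements get distinct codes.\<close>
  define j :: "'c \<Rightarrow> 'c \<Rightarrow> 'r" where "j = (\<lambda>x y. if x = y then u else v)"
  have "inj j"
    using \<open>u \<noteq> v\<close> unfolding j_def inj_def by metis
  then have "(the_inv j) (j x) = x" for x
    by (rule the_inv_f_f)
  then obtain A' where A': "left_module R A'" "the_inv j \<in> module_hom R A' A"
      "the_inv j ` carrier A' = carrier A"
    by (rule left_module_transport[where j = j and k = "the_inv j", OF assms(2)])
  \<comment> \<open>This codomain makes the map from \<open>A'\<close> surjective and still contains
    the values of \<open>h\<close> on \<open>P\<close>.\<close>
  let ?B = "M\<lparr>carrier := f ` carrier A\<rparr>"
  have "(\<lambda>x. f (the_inv j x)) \<in> module_hom R A' ?B"
    using module_hom_comp[OF A'(2) assms(4)] A'(3) by (auto simp: module_hom_def)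
  moreover have "h \<in> module_hom R P ?B"
    using assms(5,6) by (auto simp: module_hom_def)
  moreover have "(\<lambda>x. f (the_inv j x)) ` carrier A' = carrier ?B"
    using A'(3) by (simp flip: image_image)
  moreover have "left_module R ?B"
    using assms(2-4) by (rule left_module_image)
  ultimately obtain h' where "h' \<in> module_hom R P A'"
      "\<forall>x\<in>carrier P. f (the_inv j (h' x)) = h x"
    using assms(1) A'(1) unfolding projective_module_def by blast
  then show ?thesis
    using that module_hom_comp[OF _ A'(2)] by blast
qed

section \<open>Hom groups and the vanishing of Ext\<close>

lemma (in group) trivial_group_Mod_self: "trivial_group (G Mod carrier G)"
proof -
  have "carrier (G Mod carrier G) = {\<one>\<^bsub>G Mod carrier G\<^esub>}"
    using coset_join2[OF _ subgroup_self] by (auto simp: FactGroup_def RCOSETS_def)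
  moreover have "group (G Mod carrier G)"
    by (intro normal.factorgroup_is_group normal_invI subgroup_self) auto
  ultimately show ?thesis by (simp add: trivial_group_def)
qed

lemma group_hom_group:
  assumes "left_module R N" "left_module R M"
  shows "group (hom_group R M N)"
proof -
  interpret N: left_module R N by fact
  interpret M: left_module R M by fact
  note closed = module_homD(1)
  \<comment> \<open>Elements of \<open>hom_group\<close> are extensional, so pointwise constructions
    have to be cut back to the carrier.\<close>
  have restrict: "restrict f (carrier M) \<in> module_hom R M N" if "f \<in> module_hom R M N" for f
    using that M.smult_closed by (auto simp: module_hom_def)
  show ?thesis
  proof (rule groupI)
    show "\<one>\<^bsub>hom_group R M N\<^esub> \<in> carrier (hom_group R M N)"
      by (auto simp: hom_group_def N.smult_r_zero M.smult_closed intro: module_homI)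
  next
    fix f assume "f \<in> carrier (hom_group R M N)"
    then show "\<exists>g\<in>carrier (hom_group R M N). g \<otimes>\<^bsub>hom_group R M N\<^esub> f = \<one>\<^bsub>hom_group R M N\<^esub>"
      using restrict[OF module_hom_uminus[OF assms(1)]]
      by (auto simp: hom_group_def N.M.l_neg closed restrict_def
          intro!: bexI[of _ "\<lambda>x\<in>carrier M. \<ominus>\<^bsub>N\<^esub> f x"])
  next
    fix f assume "f \<in> carrier (hom_group R M N)"
    then show "\<one>\<^bsub>hom_group R M N\<^esub> \<otimes>\<^bsub>hom_group R M N\<^esub> f = f"
      by (auto simp: hom_group_def closed extensional_def restrict_def)
  qed (auto simp: hom_group_def restrict[OF module_hom_add[OF assms(1)]] closed N.M.a_assoc
      intro!: restrict_ext)
qed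

lemma hom_diff_hom:
  assumes "d n \<in> module_hom R (P (Suc n)) (P n)" "left_module R (P (Suc n))"
  shows "hom_diff P d n \<in> hom (hom_group R (P n) N) (hom_group R (P (Suc n)) N)"
proof -
  interpret M: left_module R "P (Suc n)" by fact
  show ?thesis
    using module_homD[OF assms(1)] M.smult_closed
    by (auto simp: hom_def hom_group_def hom_diff_def compose_def module_hom_def fun_eq_iff)
qed

text \<open>If the central element \<open>z\<close> kills the module resolved by \<open>P\<close>, then multiplication by \<open>z\<close> on \<open>P\<close>
  is null-homotopic. Of the homotopy only the identity \<open>d t d = z d\<close> is kept: it is what the
  extension to the next degree and the argument on cocycles need.\<close>

lemma projective_resolution_null_homotopy:
  fixes R :: "('r, 's) ring_scheme" and P :: "nat \<Rightarrow> ('r, 'c) module"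
  assumes res: "projective_resolution R M P d \<epsilon>"
    and z: "z \<in> carrier R" "\<And>a. a \<in> carrier R \<Longrightarrow> z \<otimes>\<^bsub>R\<^esub> a = a \<otimes>\<^bsub>R\<^esub> z"
    and ann: "\<And>x. x \<in> carrier M \<Longrightarrow> z \<odot>\<^bsub>M\<^esub> x = \<zero>\<^bsub>M\<^esub>"
    and uv: "(u :: 'r) \<noteq> v"
  shows "\<exists>t\<in>module_hom R (P n) (P (Suc n)). \<forall>x\<in>carrier (P (Suc n)).
           d n (t (d n x)) = z \<odot>\<^bsub>P n\<^esub> d n x"
proof (induction n)
  have P: "left_module R (P n)" "projective_module R (P n)" for n
    using res by (auto simp: projective_resolution_def projective_module_def)
  have d: "d n \<in> module_hom R (P (Suc n)) (P n)" for n
    using res by (auto simp: projective_resolution_def)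
  have id: "(\<lambda>x. x) \<in> module_hom R (P n) (P n)" for n
    by (auto simp: module_hom_def)
  {
    case 0
    have eps: "\<epsilon> \<in> module_hom R (P 0) M" and ex: "d 0 ` carrier (P 1) = a_kernel (P 0) M \<epsilon>"
      using res by (auto simp: projective_resolution_def)
    interpret P0: left_module R "P 0" by (rule P)
    \<comment> \<open>\<open>z\<close> kills \<open>M\<close>, so \<open>z x\<close> lies in the
      kernel of \<open>\<epsilon>\<close>, which is the image of \<open>d 0\<close>.\<close>
    have "(\<lambda>x. z \<odot>\<^bsub>P 0\<^esub> x) ` carrier (P 0) \<subseteq> d 0 ` carrier (P (Suc 0))"
      using z(1) ann module_homD[OF eps]
      by (auto simp: ex[simplified] a_kernel_def kernel_def P0.smult_closed)
    then obtain t where "t \<in> module_hom R (P 0) (P (Suc 0))"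
        "\<And>x. x \<in> carrier (P 0) \<Longrightarrow> d 0 (t x) = z \<odot>\<^bsub>P 0\<^esub> x"
      using projective_module_lift[OF P(2) P(1) P(1) d
          module_hom_central_smult[OF P(1) id z] _ uv] by blast
    then show ?case using module_homD[OF d] by blast
  next
    case (Suc n)
    have ex: "d (Suc n) ` carrier (P (Suc (Suc n))) = a_kernel (P (Suc n)) (P n) (d n)"
      using res by (auto simp: projective_resolution_def)
    obtain t where t: "t \<in> module_hom R (P n) (P (Suc n))"
        "\<And>x. x \<in> carrier (P (Suc n)) \<Longrightarrow> d n (t (d n x)) = z \<odot>\<^bsub>P n\<^esub> d n x"
      using Suc by blast
    interpret P0: left_module R "P n" by (rule P)
    interpret P1: left_module R "P (Suc n)" by (rule P)
    \<comment> \<open>The defect \<open>z - t d\<close> of the homotopy built so far. The induction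
      hypothesis says that \<open>d n\<close> kills it, so exactness lets it lift to
      \<open>t'\<close>.\<close>
    let ?h = "\<lambda>x. z \<odot>\<^bsub>P (Suc n)\<^esub> x \<oplus>\<^bsub>P (Suc n)\<^esub> \<ominus>\<^bsub>P (Suc n)\<^esub> t (d n x)"
    have h: "?h \<in> module_hom R (P (Suc n)) (P (Suc n))"
      by (intro module_hom_add[OF P(1)] module_hom_uminus[OF P(1)] module_hom_comp[OF d t(1)]
          module_hom_central_smult[OF P(1) id z])
    have "?h ` carrier (P (Suc n)) \<subseteq> d (Suc n) ` carrier (P (Suc (Suc n)))"
      using module_homD(1)[OF h] z(1) t(2) module_homD[OF d[of n]] module_homD[OF t(1)]
      by (auto simp: ex a_kernel_def kernel_def module_hom_minus[OF P(1) P(1) d]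
          P0.M.r_neg P0.smult_closed P1.smult_closed)
    then obtain t' where t': "t' \<in> module_hom R (P (Suc n)) (P (Suc (Suc n)))"
        "\<And>x. x \<in> carrier (P (Suc n)) \<Longrightarrow> d (Suc n) (t' x) = ?h x"
      using projective_module_lift[OF P(2) P(1) P(1) d h _ uv] by blast
    have "d (Suc n) (t' (d (Suc n) x)) = z \<odot>\<^bsub>P (Suc n)\<^esub> d (Suc n) x"
      if x: "x \<in> carrier (P (Suc (Suc n)))" for x
    proof -
      \<comment> \<open>On boundaries the correction \<open>t (d n x)\<close> drops out, since
        \<open>d d = 0\<close>.\<close>
      have "d (Suc n) x \<in> carrier (P (Suc n))" "d n (d (Suc n) x) = \<zero>\<^bsub>P n\<^esub>"
        using x ex by (auto simp: a_kernel_def kernel_def)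
      then show ?thesis
        using z(1) t' module_hom_zero[OF P(1) P(1) t(1)] by (simp add: P1.smult_closed)
    qed
    then show ?case using t'(1) by blast
  }
qed

text \<open>In positive degree the homotopy writes a cocycle as a coboundary. In degree 0 there are
  no earlier cochains, and the cocycle itself must vanish: \<open>z P 0\<close> lies in the kernel
  of \<open>\<epsilon>\<close>, the image of \<open>d 0\<close>, so \<open>z f = 0\<close> and
  \<open>f = w z f = 0\<close>.\<close>

theorem Ext_group_trivial_if_central_separates:
  fixes R :: "('r, 's) ring_scheme" and P :: "nat \<Rightarrow> ('r, 'c) module"
  assumes res: "projective_resolution R M P d \<epsilon>" and N: "left_module R N"
    and z: "z \<in> carrier R" "\<And>a. a \<in> carrier R \<Longrightarrow> z \<otimes>\<^bsub>R\<^esub> a = a \<otimes>\<^bsub>R\<^esub> z"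
    and w: "w \<in> carrier R" "\<And>a. a \<in> carrier R \<Longrightarrow> w \<otimes>\<^bsub>R\<^esub> a = a \<otimes>\<^bsub>R\<^esub> w"
    and ann: "\<And>x. x \<in> carrier M \<Longrightarrow> z \<odot>\<^bsub>M\<^esub> x = \<zero>\<^bsub>M\<^esub>"
    and unit: "\<And>y. y \<in> carrier N \<Longrightarrow> w \<odot>\<^bsub>N\<^esub> (z \<odot>\<^bsub>N\<^esub> y) = y"
    and uv: "(u :: 'r) \<noteq> v"
  shows "trivial_group (Ext_group R P d N i)"
proof -
  interpret N: left_module R N by (rule N)
  have P: "left_module R (P n)" for n
    using res by (auto simp: projective_resolution_def projective_module_def)
  have d: "d n \<in> module_hom R (P (Suc n)) (P n)" for n
    using res by (auto simp: projective_resolution_def)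
  have ghom: "group_hom (hom_group R (P n) N) (hom_group R (P (Suc n)) N) (hom_diff P d n)" for n
    by (intro group_hom.intro group_hom_axioms.intro group_hom_group hom_diff_hom N P d)
  have cocycle: "f \<in> cocycles R P d N n \<longleftrightarrow> f \<in> module_hom R (P n) N \<and>
      f \<in> extensional (carrier (P n)) \<and> (\<forall>x\<in>carrier (P (Suc n)). f (d n x) = \<zero>\<^bsub>N\<^esub>)" for f n
    by (auto simp: cocycles_def kernel_def hom_group_def hom_diff_def compose_def fun_eq_iff
        restrict_def)
  have "cocycles R P d N i = coboundaries R P d N i"
  proof (cases i)
    case 0
    have eps: "\<epsilon> \<in> module_hom R (P 0) M" and ex: "d 0 ` carrier (P 1) = a_kernel (P 0) M \<epsilon>"
      using res by (auto simp: projective_resolution_def)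
    interpret P0: left_module R "P 0" by (rule P)
    have "f = \<one>\<^bsub>hom_group R (P 0) N\<^esub>" if f: "f \<in> cocycles R P d N 0" for f
    proof -
      have "f x = \<zero>\<^bsub>N\<^esub>" if x: "x \<in> carrier (P 0)" for x
      proof -
        have "z \<odot>\<^bsub>P 0\<^esub> x \<in> d 0 ` carrier (P 1)"
          unfolding ex using x z(1) ann module_homD[OF eps]
          by (auto simp: a_kernel_def kernel_def P0.smult_closed)
        then have "f (z \<odot>\<^bsub>P 0\<^esub> x) = \<zero>\<^bsub>N\<^esub>"
          using f by (auto simp: cocycle)
        then have "z \<odot>\<^bsub>N\<^esub> f x = \<zero>\<^bsub>N\<^esub>" and "f x \<in> carrier N"
          using f x z(1) by (auto simp: cocycle module_homD)
        then show ?thesis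
          using unit N.smult_r_zero[OF w(1)] by metis
      qed
      then show ?thesis
        using f by (auto simp: cocycle hom_group_def extensional_def fun_eq_iff restrict_def)
    qed
    moreover have "\<one>\<^bsub>hom_group R (P 0) N\<^esub> \<in> cocycles R P d N 0"
      unfolding cocycles_def
      by (intro subgroup.one_closed group_hom.subgroup_kernel ghom)
    ultimately have "cocycles R P d N 0 = {\<one>\<^bsub>hom_group R (P 0) N\<^esub>}"
      by blast
    then show ?thesis
      unfolding 0 coboundaries.simps .
  next
    case (Suc n)
    have ex: "d (Suc n) ` carrier (P (Suc (Suc n))) = a_kernel (P (Suc n)) (P n) (d n)"
      using res by (auto simp: projective_resolution_def)
    interpret P0: left_module R "P n" by (rule P)
    interpret P1: left_module R "P (Suc n)" by (rule P)
    obtain t where t: "t \<in> module_hom R (P n) (P (Suc n))"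
        "\<And>x. x \<in> carrier (P (Suc n)) \<Longrightarrow> d n (t (d n x)) = z \<odot>\<^bsub>P n\<^esub> d n x"
      using projective_resolution_null_homotopy[OF res z ann uv] by blast
    have "f \<in> hom_diff P d n ` carrier (hom_group R (P n) N)"
      if f: "f \<in> cocycles R P d N (Suc n)" for f
    proof
      have fh: "f \<in> module_hom R (P (Suc n)) N" using f by (simp add: cocycle)
      \<comment> \<open>\<open>z x - t (d n x)\<close> is killed by \<open>d n\<close>, hence a
        boundary, and cocycles vanish on boundaries.\<close>
      have sub: "f (t (d n x)) = z \<odot>\<^bsub>N\<^esub> f x" if x: "x \<in> carrier (P (Suc n))" for x
      proof -
        note c = x z(1) module_homD(1)[OF d] module_homD(1)[OF t(1)]
        have "z \<odot>\<^bsub>P (Suc n)\<^esub> x \<oplus>\<^bsub>P (Suc n)\<^esub> \<ominus>\<^bsub>P (Suc n)\<^esub> t (d n x)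
            \<in> d (Suc n) ` carrier (P (Suc (Suc n)))"
          using c t(2) module_homD[OF d[of n]]
          by (auto simp: ex a_kernel_def kernel_def module_hom_minus[OF P P d]
              P0.M.r_neg P0.smult_closed P1.smult_closed)
        then have "f (z \<odot>\<^bsub>P (Suc n)\<^esub> x \<oplus>\<^bsub>P (Suc n)\<^esub> \<ominus>\<^bsub>P (Suc n)\<^esub> t (d n x)) = \<zero>\<^bsub>N\<^esub>"
          using f by (auto simp: cocycle)
        then have "z \<odot>\<^bsub>N\<^esub> f x \<oplus>\<^bsub>N\<^esub> \<ominus>\<^bsub>N\<^esub> f (t (d n x)) = \<zero>\<^bsub>N\<^esub>"
          using c by (simp add: module_homD[OF fh] module_hom_minus[OF P N fh] P1.smult_closed)
        then show ?thesis
          using c N.M.minus_equality[of "z \<odot>\<^bsub>N\<^esub> f x" "\<ominus>\<^bsub>N\<^esub> f (t (d n x))"]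
          by (simp add: N.smult_closed module_homD(1)[OF fh])
      qed
      \<comment> \<open>Applying \<open>w\<close> to \<open>z f = f t d\<close> cancels
        \<open>z\<close> and exhibits a preimage of \<open>f\<close>.\<close>
      let ?g = "\<lambda>x\<in>carrier (P n). w \<odot>\<^bsub>N\<^esub> f (t x)"
      show "f = hom_diff P d n ?g"
        using f sub unit
        by (auto simp: hom_diff_def compose_def cocycle extensional_def fun_eq_iff
            module_homD(1)[OF d] module_homD(1)[OF fh])
      have "(\<lambda>x. w \<odot>\<^bsub>N\<^esub> f (t x)) \<in> module_hom R (P n) N"
        by (intro module_hom_central_smult[OF N _ w] module_hom_comp[OF t(1) fh])
      then show "?g \<in> carrier (hom_group R (P n) N)"
        by (auto simp: hom_group_def module_hom_def P0.smult_closed)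
    qed
    moreover have "hom_diff P d n f \<in> cocycles R P d N (Suc n)"
      if f: "f \<in> carrier (hom_group R (P n) N)" for f
    proof -
      have "hom_diff P d n f \<in> carrier (hom_group R (P (Suc n)) N)"
        using f hom_diff_hom[of d n R P N] d P by (auto simp: hom_def)
      moreover have "f (d n (d (Suc n) x)) = \<zero>\<^bsub>N\<^esub>" and "d (Suc n) x \<in> carrier (P (Suc n))"
        if "x \<in> carrier (P (Suc (Suc n)))" for x
      proof -
        have "d (Suc n) x \<in> a_kernel (P (Suc n)) (P n) (d n)"
          using that ex by blast
        then show "f (d n (d (Suc n) x)) = \<zero>\<^bsub>N\<^esub>" "d (Suc n) x \<in> carrier (P (Suc n))"
          using f module_hom_zero[OF P N] by (auto simp: a_kernel_def kernel_def hom_group_def)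
      qed
      ultimately show ?thesis
        by (auto simp: cocycle hom_group_def hom_diff_def compose_def)
    qed
    ultimately show ?thesis
      unfolding Suc coboundaries.simps by blast
  qed
  moreover have "group (hom_group R (P i) N\<lparr>carrier := cocycles R P d N i\<rparr>)"
    unfolding cocycles_def
    by (intro subgroup.subgroup_is_group group_hom.subgroup_kernel ghom group_hom_group N P)
  ultimately show ?thesis
    unfolding Ext_group_def using group.trivial_group_Mod_self by fastforce
qed

section \<open>Subquotients and elements that annihilate them\<close>

lemma abelian_group_regular_module:
  assumes "ring R"
  shows "abelian_group (regular_module R)"
proof -
  interpret ring R by fact
  show ?thesis
  proof (rule abelian_groupI)
    fix x assume "x \<in> carrier (regular_module R)"
    then show "\<exists>y\<in>carrier (regular_module R). y \<oplus>\<^bsub>regular_module R\<^esub> x = \<zero>\<^bsub>regular_module R\<^esub>"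
      by (auto simp: regular_module_def intro: bexI[of _ "\<ominus>\<^bsub>R\<^esub> x"] l_neg)
  qed (auto simp: regular_module_def a_ac)
qed

lemma (in ring) additive_subgroup_left_ideal_pair:
  assumes u: "u \<in> carrier R" and v: "v \<in> carrier R"
  shows "additive_subgroup {a \<otimes> u \<oplus> b \<otimes> v | a b. a \<in> carrier R \<and> b \<in> carrier R} R"
    (is "additive_subgroup ?L R")
proof (intro additive_subgroupI add.subgroupI)
  show "?L \<subseteq> carrier R" using u v by auto
  show "?L \<noteq> {}" by blast
next
  fix x assume "x \<in> ?L"
  then obtain a b where "x = a \<otimes> u \<oplus> b \<otimes> v" and "a \<in> carrier R" "b \<in> carrier R"
    by blast
  moreover from this have "\<ominus> x = (\<ominus> a) \<otimes> u \<oplus> (\<ominus> b) \<otimes> v"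
    using u v by (simp add: minus_add l_minus)
  ultimately show "\<ominus> x \<in> ?L" by blast
next
  fix x y assume "x \<in> ?L" "y \<in> ?L"
  then obtain a b c d where "x = a \<otimes> u \<oplus> b \<otimes> v" "y = c \<otimes> u \<oplus> d \<otimes> v"
      and "a \<in> carrier R" "b \<in> carrier R" "c \<in> carrier R" "d \<in> carrier R"
    by blast
  moreover from this have "x \<oplus> y = (a \<oplus> c) \<otimes> u \<oplus> (b \<oplus> d) \<otimes> v"
    using u v by (simp add: l_distr a_ac)
  ultimately show "x \<oplus> y \<in> ?L" by blast
qed

lemma abelian_group_quotient_module:
  assumes "abelian_group M" "additive_subgroup N M"
  shows "abelian_group (quotient_module M N)"
proof -
  interpret abelian_subgroup N M
    using assms by (intro abelian_subgroupI3)
  interpret Q: comm_group "M A_Mod N"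
    by (rule a_factorgroup_is_comm_group)
  show ?thesis
  proof (rule abelian_groupI)
    fix C D assume "C \<in> carrier (quotient_module M N)" "D \<in> carrier (quotient_module M N)"
    then show "C \<oplus>\<^bsub>quotient_module M N\<^esub> D = D \<oplus>\<^bsub>quotient_module M N\<^esub> C"
      using Q.m_comm[of C D] by (simp add: quotient_module_def A_FactGroup_def')
  next
    fix C assume "C \<in> carrier (quotient_module M N)"
    then show "\<exists>D\<in>carrier (quotient_module M N).
        D \<oplus>\<^bsub>quotient_module M N\<^esub> C = \<zero>\<^bsub>quotient_module M N\<^esub>"
      using a_setinv_closed a_rcosets_inv_mult_group_eq by (auto simp: quotient_module_def)
  qed (simp_all add: quotient_module_def a_setmult_closed a_rcosets_assoc a_subgroup_in_rcosets
      rcosets_add_eq)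
qed

text \<open>The product with a coset is a union over all its representatives \<open>y\<close>. Every
  member of this union is \<open>N\<close>, so no choice of representative has to be justified; the
  coset only has to be nonempty.\<close>

lemma quotient_module_annihilated:
  assumes "abelian_group M" "additive_subgroup N M"
    and ann: "\<And>x. x \<in> carrier M \<Longrightarrow> z \<odot>\<^bsub>M\<^esub> x \<in> N"
    and C: "C \<in> carrier (quotient_module M N)"
  shows "z \<odot>\<^bsub>quotient_module M N\<^esub> C = \<zero>\<^bsub>quotient_module M N\<^esub>"
proof -
  interpret abelian_subgroup N M
    using assms by (intro abelian_subgroupI3)
  obtain x where x: "x \<in> carrier M" "C = N +>\<^bsub>M\<^esub> x"
    using C by (auto simp: quotient_module_def A_RCOSETS_def')
  then have "x \<in> C" and "C \<subseteq> carrier M"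
    using a_rcos_self a_r_coset_subset_G a_subset by auto
  then have "N +>\<^bsub>M\<^esub> (z \<odot>\<^bsub>M\<^esub> y) = N" if "y \<in> C" for y
    using that ann a_rcos_const by blast
  then show ?thesis
    using \<open>x \<in> C\<close> by (auto simp: quotient_module_def)
qed

lemma is_subquotient_annihilated:
  assumes S: "left_module R S" and sub: "is_subquotient R S M" and M: "abelian_group M"
    and z: "z \<in> carrier R" and ann: "\<And>x. x \<in> carrier M \<Longrightarrow> z \<odot>\<^bsub>M\<^esub> x = \<zero>\<^bsub>M\<^esub>"
    and x: "x \<in> carrier S"
  shows "z \<odot>\<^bsub>S\<^esub> x = \<zero>\<^bsub>S\<^esub>"
proof -
  interpret S: left_module R S by fact
  obtain A B f where A: "submodule A R M" and B: "submodule B R M"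
      and f: "f \<in> module_hom R S (quotient_module (M\<lparr>carrier := A\<rparr>) B)"
        "bij_betw f (carrier S) (carrier (quotient_module (M\<lparr>carrier := A\<rparr>) B))"
    using sub by (auto simp: is_subquotient_def module_isomorphic_def)
  let ?Q = "quotient_module (M\<lparr>carrier := A\<rparr>) B"
  have "A \<subseteq> carrier M"
    using subgroup.subset[OF submodule.axioms(1)[OF A]] by simp
  \<comment> \<open>A coset of \<open>B\<close> in \<open>A\<close> is also a coset of
    \<open>B\<close> in \<open>M\<close>, so annihilation can be computed in the quotient of
    \<open>M\<close>.\<close>
  then have Q: "carrier ?Q \<subseteq> carrier (quotient_module M B)"
    by (auto simp: quotient_module_def A_RCOSETS_def' a_r_coset_def')
  have B': "additive_subgroup B M"
    using submodule.axioms(1)[OF B] by (rule additive_subgroupI)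
  have smult: "z \<odot>\<^bsub>?Q\<^esub> C = B" if "C \<in> carrier ?Q" for C
  proof -
    have "z \<odot>\<^bsub>quotient_module M B\<^esub> C = \<zero>\<^bsub>quotient_module M B\<^esub>"
      using that Q ann additive_subgroup.zero_closed[OF B']
      by (intro quotient_module_annihilated M B') auto
    then show ?thesis
      by (simp add: quotient_module_def a_r_coset_def')
  qed
  have "f (z \<odot>\<^bsub>S\<^esub> y) = B" if "y \<in> carrier S" for y
    using that z module_homD(1,3)[OF f(1)] smult by simp
  \<comment> \<open>Comparing with \<open>z\<close> times zero, instead of evaluating
    \<open>f\<close> at zero, avoids proving that the subquotient \<open>?Q\<close> is itself a left
    module.\<close>
  then have "f (z \<odot>\<^bsub>S\<^esub> x) = f (z \<odot>\<^bsub>S\<^esub> \<zero>\<^bsub>S\<^esub>)"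
    using x by simp
  then have "z \<odot>\<^bsub>S\<^esub> x = z \<odot>\<^bsub>S\<^esub> \<zero>\<^bsub>S\<^esub>"
    using inj_onD[OF bij_betw_imp_inj_on[OF f(2)]] x z S.smult_closed S.M.zero_closed by blast
  then show ?thesis using S.smult_r_zero z by simp
qed

section \<open>The smash product is a ring\<close>

lemma poly_mapping_sum_single:
  fixes f :: "'a \<Rightarrow>\<^sub>0 'b::comm_monoid_add"
  shows "f = (\<Sum>w\<in>Poly_Mapping.keys f. Poly_Mapping.single w (Poly_Mapping.lookup f w))"
  by (rule poly_mapping_eqI)
     (simp add: lookup_sum lookup_single when_def sum.delta in_keys_iff)

lemma poly_mapping_induct_single [case_names single add]:
  fixes f :: "'a \<Rightarrow>\<^sub>0 'b::comm_monoid_add"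
  assumes "\<And>w c. P (Poly_Mapping.single w c)" "\<And>f g. P f \<Longrightarrow> P g \<Longrightarrow> P (f + g)"
  shows "P f"
proof -
  have P0: "P 0" using assms(1)[of undefined 0] by simp
  have "P (\<Sum>w\<in>A. Poly_Mapping.single w (Poly_Mapping.lookup f w))" if "finite A" for A
    using that by (induction A rule: finite_induct) (auto intro: assms P0)
  then show ?thesis
    by (subst poly_mapping_sum_single) simp
qed

lemma single_0_commute:
  fixes f :: "'a::monoid_add \<Rightarrow>\<^sub>0 'b::comm_semiring_1"
  shows "f * Poly_Mapping.single 0 c = Poly_Mapping.single 0 c * f"
  by (induction f rule: poly_mapping_induct_single)
     (simp_all add: mult_single mult.commute distrib_left distrib_right)

text \<open>Cancellation can make the support of a sum smaller than the union of the supports.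
  Summing over any finite superset gives both sides of additivity a common index set.\<close>

lemma g_act_supset:
  assumes "finite W" "Poly_Mapping.keys f \<subseteq> W"
  shows "g_act f = (\<Sum>w\<in>W. Poly_Mapping.single 0 (Poly_Mapping.lookup f w)
           * prod_list (map g_letter (letters w)))"
  unfolding g_act_def using assms by (intro sum.mono_neutral_left) (auto simp: in_keys_iff)

lemma g_act_add: "g_act (f + h) = g_act f + g_act h"
proof -
  let ?W = "Poly_Mapping.keys f \<union> Poly_Mapping.keys h"
  have "g_act (f + h) = (\<Sum>w\<in>?W. Poly_Mapping.single 0 (Poly_Mapping.lookup (f + h) w)
           * prod_list (map g_letter (letters w)))"
    using keys_add[of f h] by (intro g_act_supset) auto
  then show ?thesis
    by (simp add: g_act_supset[of ?W f] g_act_supset[of ?W h] lookup_add single_add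
        distrib_right sum.distrib)
qed

lemma g_act_single:
  "g_act (Poly_Mapping.single w c)
     = Poly_Mapping.single 0 c * prod_list (map g_letter (letters w))"
  by (subst g_act_supset[of "{w}"]) auto

lemma g_act_0: "g_act 0 = 0"
  by (simp add: g_act_def)

lemma g_act_const: "g_act (Poly_Mapping.single 0 c) = Poly_Mapping.single 0 c"
  by (simp add: g_act_single zero_word_def)

lemma letters_add: "letters (u + v) = letters u @ letters v"
  by (simp add: plus_word_def)

text \<open>Both sides are additive in each factor, so monomials suffice. There multiplication
  concatenates words, and only the scalar \<open>d\<close> has to be moved past the image of
  \<open>u\<close>.\<close>

lemma g_act_mult: "g_act (f * h) = g_act f * g_act h"
proof (induction f rule: poly_mapping_induct_single)
  case (single u c)
  show ?case
  proof (induction h rule: poly_mapping_induct_single)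
    case (single v d)
    let ?G = "\<lambda>w. prod_list (map g_letter (letters w)) :: 'a free_alg"
    have "g_act (Poly_Mapping.single u c * Poly_Mapping.single v d)
        = Poly_Mapping.single 0 c * (Poly_Mapping.single 0 d * ?G u) * ?G v"
      by (simp add: mult_single g_act_single letters_add flip: mult.assoc)
    also have "\<dots> = Poly_Mapping.single 0 c * (?G u * Poly_Mapping.single 0 d) * ?G v"
      by (simp only: single_0_commute)
    finally show ?case
      by (simp add: g_act_single mult.assoc)
  qed (simp add: distrib_left g_act_add)
qed (simp add: distrib_right g_act_add)

lemma g_act_1: "g_act 1 = 1"
  using g_act_const[of 1] by simp

lemma g_act_fa_x: "g_act fa_x = fa_x"
  by (simp add: fa_x_def g_act_single)

lemma g_act_fa_y: "g_act fa_y = fa_x + fa_y"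
  by (simp add: fa_y_def g_act_single)

lemma g_pow_add: "(g_act ^^ n) (f + h) = (g_act ^^ n) f + (g_act ^^ n) h"
  by (induction n) (simp_all add: g_act_add)

lemma g_pow_mult: "(g_act ^^ n) (f * h) = (g_act ^^ n) f * (g_act ^^ n) h"
  by (induction n) (simp_all add: g_act_mult)

lemma g_pow_0: "(g_act ^^ n) 0 = 0"
  by (induction n) (simp_all add: g_act_0)

lemma g_pow_const: "(g_act ^^ n) (Poly_Mapping.single 0 c) = Poly_Mapping.single 0 c"
  by (induction n) (simp_all add: g_act_const)

lemma g_pow_1: "(g_act ^^ n) 1 = 1"
  by (induction n) (simp_all add: g_act_1)

lemma g_pow_sum: "(g_act ^^ n) (sum f A) = (\<Sum>i\<in>A. (g_act ^^ n) (f i))"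
  by (induction A rule: infinite_finite_induct) (simp_all add: g_pow_0 g_pow_add)

lemma g_pow_fa_x: "(g_act ^^ n) fa_x = fa_x"
  by (induction n) (simp_all add: g_act_fa_x)

lemma g_pow_fa_x_power: "(g_act ^^ n) (fa_x ^ m) = fa_x ^ m"
  by (induction m) (simp_all add: g_pow_1 g_pow_mult g_pow_fa_x)

lemma g_pow_fa_y: "(g_act ^^ n) fa_y = (of_nat n * fa_x + fa_y :: 'k::field free_alg)"
proof (induction n)
  case (Suc n)
  have "g_act (of_nat n :: 'k free_alg) = of_nat n"
    using g_act_const[of "of_nat n :: 'k"] by simp
  then show ?case
    using Suc by (simp add: g_act_add g_act_mult g_act_fa_x g_act_fa_y algebra_simps)
qed simp

lemma single_Word_Cons:
  "Poly_Mapping.single (Word (a # ls)) c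
     = (case a of LX \<Rightarrow> fa_x | LY \<Rightarrow> fa_y) * Poly_Mapping.single (Word ls) c"
  by (cases a) (simp_all add: fa_x_def fa_y_def mult_single plus_word_def)

text \<open>Scalars, \<open>fa_x\<close> and \<open>fa_y\<close> generate the algebra. This form
  suits properties that define a subalgebra, such as being fixed by a power of \<open>g\<close> or
  commuting with \<open>x^p\<close>.\<close>

lemma free_alg_induct [case_names const x y add mult]:
  assumes "\<And>c. P (Poly_Mapping.single 0 c)" "P fa_x" "P fa_y"
    and "\<And>f h. P f \<Longrightarrow> P h \<Longrightarrow> P (f + h)" "\<And>f h. P f \<Longrightarrow> P h \<Longrightarrow> P (f * h)"
  shows "P f"
proof (induction f rule: poly_mapping_induct_single)
  case (single w c)
  have "P (Poly_Mapping.single (Word ls) c)" for ls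
  proof (induction ls)
    case Nil
    show ?case using assms(1)[of c] by (simp add: zero_word_def)
  next
    case (Cons a ls)
    then show ?case
      unfolding single_Word_Cons by (intro assms(5)) (auto split: letter.split intro: assms)
  qed
  then show ?case by (cases w) simp
qed (rule assms)

lemma of_nat_CHAR_free_alg: "of_nat CHAR('k) = (0 :: 'k::field free_alg)"
  using single_of_nat[of "CHAR('k)", where 'a = word and 'b = 'k] by (simp flip: single_of_nat)

text \<open>Each application of \<open>g\<close> adds one \<open>x\<close> to \<open>y\<close>, so
  after p of them \<open>y\<close> has gained \<open>p x = 0\<close>; the other generators are fixed
  throughout.\<close>

lemma g_pow_CHAR: "(g_act ^^ CHAR('k)) f = (f :: 'k::field free_alg)"
  by (induction f rule: free_alg_induct)
     (simp_all add: g_pow_const g_pow_add g_pow_mult g_pow_fa_y of_nat_CHAR_free_alg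
       g_pow_fa_x)

section \<open>Multiplication in the smash product\<close>

lemma smash_mult:
  "(a \<otimes>\<^bsub>smash p\<^esub> b) n = (if n < p
     then \<Sum>i<p. \<Sum>j<p. if (i + j) mod p = n then a i * (g_act ^^ i) (b j) else 0 else 0)"
  by (simp add: smash_def)

lemma of_free_alg_smash_mult:
  assumes "a \<in> carrier (smash p)"
  shows "of_free_alg f \<otimes>\<^bsub>smash p\<^esub> a = (\<lambda>n. f * a n)"
proof
  fix n
  have "(\<Sum>i<p. \<Sum>j<p. if (i + j) mod p = n then of_free_alg f i * (g_act ^^ i) (a j) else 0)
      = (\<Sum>i<p. if i = 0 then \<Sum>j<p. if j = n then f * a j else 0 else 0)"
    by (intro sum.cong refl) (auto simp: of_free_alg_def intro!: sum.cong sum.neutral)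
  then show "(of_free_alg f \<otimes>\<^bsub>smash p\<^esub> a) n = f * a n"
    using assms by (auto simp: smash_mult smash_def not_less)
qed

text \<open>Moving \<open>f\<close> to the left past \<open>g^n\<close> applies \<open>g^n\<close>
  to it.\<close>

lemma smash_mult_of_free_alg:
  assumes "a \<in> carrier (smash p)"
  shows "a \<otimes>\<^bsub>smash p\<^esub> of_free_alg f = (\<lambda>n. a n * (g_act ^^ n) f)"
proof
  fix n
  have "(\<Sum>i<p. \<Sum>j<p. if (i + j) mod p = n then a i * (g_act ^^ i) (of_free_alg f j) else 0)
      = (\<Sum>i<p. \<Sum>j<p. if j = 0 then if i = n then a i * (g_act ^^ i) f else 0 else 0)"
    by (intro sum.cong refl) (auto simp: of_free_alg_def g_pow_0)
  then show "(a \<otimes>\<^bsub>smash p\<^esub> of_free_alg f) n = a n * (g_act ^^ n) f"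
    using assms by (auto simp: smash_mult smash_def not_less)
qed

text \<open>Both sides are the sum of \<open>?F i j k\<close> over the triples with
  \<open>i + j + k\<close> congruent to \<open>n\<close>. The inner product reduces its exponent
  modulo \<open>p\<close>, so the automorphism must not notice this reduction; here
  \<open>g^p = 1\<close>, hence the characteristic, enters.\<close>

lemma smash_assoc:
  fixes a b c :: "nat \<Rightarrow> 'k::field free_alg"
  assumes char: "CHAR('k) = p"
  shows "(a \<otimes>\<^bsub>smash p\<^esub> b) \<otimes>\<^bsub>smash p\<^esub> c = a \<otimes>\<^bsub>smash p\<^esub> (b \<otimes>\<^bsub>smash p\<^esub> c)"
proof
  fix n
  have g_mod: "(g_act ^^ (m mod p)) f = (g_act ^^ m) f" for m and f :: "'k free_alg"
    using g_pow_CHAR[of f] by (simp add: char funpow_mod_eq)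
  let ?F = "\<lambda>i j k. if (i + j + k) mod p = n
    then a i * (g_act ^^ i) (b j) * (g_act ^^ (i + j)) (c k) else 0"
  show "((a \<otimes>\<^bsub>smash p\<^esub> b) \<otimes>\<^bsub>smash p\<^esub> c) n = (a \<otimes>\<^bsub>smash p\<^esub> (b \<otimes>\<^bsub>smash p\<^esub> c)) n"
  proof (cases "n < p")
    case True
    \<comment> \<open>The exponent \<open>m\<close> of the inner product is kept as a separate index
      tied to \<open>i + j\<close>, so that the sums can be interchanged and \<open>m\<close> summed
      away last.\<close>
    have l: "(if (m + k) mod p = n then
          (a \<otimes>\<^bsub>smash p\<^esub> b) m * (g_act ^^ m) (c k) else 0)
        = (\<Sum>i<p. \<Sum>j<p. if m = (i + j) mod p then ?F i j k else 0)" if "m < p" for m k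
    proof (cases "(m + k) mod p = n")
      case True
      then show ?thesis
        using that unfolding smash_mult
        by (auto simp: sum_distrib_right g_mod mod_add_left_eq intro!: sum.cong)
    qed (auto simp: mod_add_left_eq intro!: sum.neutral)
    have r: "(if (i + m) mod p = n then
          a i * (g_act ^^ i) ((b \<otimes>\<^bsub>smash p\<^esub> c) m) else 0)
        = (\<Sum>j<p. \<Sum>k<p. if m = (j + k) mod p then ?F i j k else 0)" if "m < p" for i m
    proof (cases "(i + m) mod p = n")
      case True
      then show ?thesis
        using that unfolding smash_mult
        by (auto simp: sum_distrib_left g_pow_sum g_pow_mult g_pow_0 funpow_add mod_add_right_eq
            mult.assoc add.assoc intro!: sum.cong)
    qed (auto simp: mod_add_right_eq add.assoc intro!: sum.neutral)
    have "((a \<otimes>\<^bsub>smash p\<^esub> b) \<otimes>\<^bsub>smash p\<^esub> c) n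
        = (\<Sum>m<p. \<Sum>k<p. \<Sum>i<p. \<Sum>j<p. if m = (i + j) mod p then ?F i j k else 0)"
      using True by (subst smash_mult) (simp add: l)
    also have "\<dots> = (\<Sum>k<p. \<Sum>i<p. \<Sum>j<p. \<Sum>m<p. if m = (i + j) mod p then ?F i j k else 0)"
      by (subst sum.swap, rule sum.cong[OF refl], subst sum.swap, rule sum.cong[OF refl],
          subst sum.swap, rule refl)
    also have "\<dots> = (\<Sum>k<p. \<Sum>i<p. \<Sum>j<p. ?F i j k)"
      using True by (intro sum.cong refl) simp
    also have "\<dots> = (\<Sum>i<p. \<Sum>j<p. \<Sum>k<p. ?F i j k)"
      by (subst sum.swap, rule sum.cong[OF refl], subst sum.swap, rule refl)
    also have "\<dots> = (\<Sum>i<p. \<Sum>j<p. \<Sum>k<p. \<Sum>m<p. if m = (j + k) mod p then ?F i j k else 0)"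
      using True by (intro sum.cong refl) simp
    also have "\<dots> = (\<Sum>i<p. \<Sum>m<p. \<Sum>j<p. \<Sum>k<p. if m = (j + k) mod p then ?F i j k else 0)"
      by (rule sum.cong[OF refl], subst (2) sum.swap, rule sum.cong[OF refl], subst sum.swap, rule refl)
    also have "\<dots> = (a \<otimes>\<^bsub>smash p\<^esub> (b \<otimes>\<^bsub>smash p\<^esub> c)) n"
      using True by (subst smash_mult[where a = a and b = "b \<otimes>\<^bsub>smash p\<^esub> c"]) (simp add: r)
    finally show ?thesis .
  qed (simp add: smash_mult)
qed

lemma smash_distrib:
  "(a \<oplus>\<^bsub>smash p\<^esub> b) \<otimes>\<^bsub>smash p\<^esub> c = a \<otimes>\<^bsub>smash p\<^esub> c \<oplus>\<^bsub>smash p\<^esub> b \<otimes>\<^bsub>smash p\<^esub> c"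
  "a \<otimes>\<^bsub>smash p\<^esub> (b \<oplus>\<^bsub>smash p\<^esub> c) = a \<otimes>\<^bsub>smash p\<^esub> b \<oplus>\<^bsub>smash p\<^esub> a \<otimes>\<^bsub>smash p\<^esub> c"
  by (auto simp: smash_def fun_eq_iff distrib_left distrib_right g_pow_add
      simp flip: sum.distrib intro!: sum.cong)

lemma one_smash: "\<one>\<^bsub>smash p\<^esub> = of_free_alg 1"
  by (simp add: smash_def of_free_alg_def)

lemma of_free_alg_closed: "0 < p \<Longrightarrow> of_free_alg f \<in> carrier (smash p)"
  by (simp add: smash_def of_free_alg_def)

lemma ring_smash:
  assumes "CHAR('k) = p" "0 < p"
  shows "ring (smash p :: (nat \<Rightarrow> 'k::field free_alg) ring)"
proof (rule ringI)
  show "abelian_group (smash p :: (nat \<Rightarrow> 'k free_alg) ring)"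
  proof (rule abelian_groupI)
    fix a :: "nat \<Rightarrow> 'k free_alg" assume "a \<in> carrier (smash p)"
    then show "\<exists>b\<in>carrier (smash p). b \<oplus>\<^bsub>smash p\<^esub> a = \<zero>\<^bsub>smash p\<^esub>"
      by (intro bexI[of _ "\<lambda>i. - a i"]) (auto simp: smash_def)
  qed (auto simp: smash_def add_ac)
  show "Group.monoid (smash p :: (nat \<Rightarrow> 'k free_alg) ring)"
  proof (rule monoidI)
    show "a \<otimes>\<^bsub>smash p\<^esub> b \<in> carrier (smash p)" for a b :: "nat \<Rightarrow> 'k free_alg"
      by (simp add: smash_def)
  qed (use assms in \<open>auto simp: one_smash smash_assoc of_free_alg_smash_mult of_free_alg_closed
         smash_mult_of_free_alg g_pow_1\<close>)
qed (simp_all add: smash_distrib)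

section \<open>The central element \<open>x\<^sup>p\<close>\<close>

text \<open>\<open>CHAR_p\<close> makes the smash product associative, and
  \<open>l_group_alg\<close> puts the defining relation into its carrier.\<close>

locale char_p_smash =
  fixes p :: nat and l :: "nat \<Rightarrow> 'k::field"
  assumes prime_p: "prime p" and CHAR_p: "CHAR('k) = p" and l_group_alg: "l \<in> group_alg p"
begin

abbreviation H where "H \<equiv> H_alg p l"
abbreviation \<phi> where "\<phi> f \<equiv> H_proj p l (of_free_alg f)"

lemma p_pos: "0 < p"
  using prime_p by (rule prime_gt_0_nat)

sublocale A: ring "smash p :: (nat \<Rightarrow> 'k free_alg) ring"
  using CHAR_p p_pos by (rule ring_smash)

lemma of_group_alg_closed: "of_group_alg l \<in> carrier (smash p)"
  using l_group_alg by (simp add: group_alg_def smash_def of_group_alg_def)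

lemma ideal_H_rel: "ideal (H_rel_ideal p l) (smash p)"
  unfolding H_rel_ideal_def
  by (intro A.genideal_ideal) (simp add: of_free_alg_closed p_pos of_group_alg_closed)

sublocale H: ring H
  unfolding H_alg_def using ideal_H_rel by (rule ideal.quotient_is_ring)

lemma H_proj_hom: "H_proj p l \<in> ring_hom (smash p) H"
  using ideal.rcos_ring_hom[OF ideal_H_rel] by (simp add: H_alg_def H_proj_def[abs_def])

lemma carrier_H: "carrier H = H_proj p l ` carrier (smash p)"
  by (auto simp: H_alg_def FactRing_def A_RCOSETS_def' H_proj_def)

lemma \<phi>_closed: "\<phi> f \<in> carrier H"
  using p_pos by (simp add: carrier_H of_free_alg_closed)

lemma \<phi>_add: "\<phi> (f + h) = \<phi> f \<oplus>\<^bsub>H\<^esub> \<phi> h"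
proof -
  have "of_free_alg (f + h) = of_free_alg f \<oplus>\<^bsub>smash p\<^esub> of_free_alg h"
    by (auto simp: of_free_alg_def smash_def)
  then show ?thesis
    using ring_hom_add[OF H_proj_hom] by (simp add: of_free_alg_closed p_pos)
qed

lemma \<phi>_mult: "\<phi> (f * h) = \<phi> f \<otimes>\<^bsub>H\<^esub> \<phi> h"
proof -
  have "of_free_alg (f * h) = of_free_alg f \<otimes>\<^bsub>smash p\<^esub> of_free_alg h"
    by (auto simp: of_free_alg_smash_mult of_free_alg_closed p_pos) (auto simp: of_free_alg_def)
  then show ?thesis
    using ring_hom_mult[OF H_proj_hom] by (simp add: of_free_alg_closed p_pos)
qed

lemma \<phi>_1: "\<phi> 1 = \<one>\<^bsub>H\<^esub>"
  using ring_hom_one[OF H_proj_hom] by (simp add: one_smash)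

lemma \<phi>_0: "\<phi> 0 = \<zero>\<^bsub>H\<^esub>"
  using \<phi>_add[of 0 0] H.add.r_cancel_one'[OF \<phi>_closed \<phi>_closed] by simp

section \<open>Commutators with powers of \<open>x\<close>, and centrality\<close>

lemma \<phi>_commutator: "\<phi> (fa_x * fa_y - fa_y * fa_x) = H_proj p l (of_group_alg l)"
proof -
  let ?c = "of_free_alg (fa_x * fa_y - fa_y * fa_x) :: nat \<Rightarrow> 'k free_alg"
  let ?r = "?c \<ominus>\<^bsub>smash p\<^esub> of_group_alg l"
  interpret I: ideal "H_rel_ideal p l" "smash p" by (rule ideal_H_rel)
  have c: "?c \<in> carrier (smash p)"
    by (simp add: of_free_alg_closed p_pos)
  then have r: "?r \<in> H_rel_ideal p l"
    unfolding H_rel_ideal_def by (intro A.genideal_self') (simp add: of_group_alg_closed)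
  have "?c = ?r \<oplus>\<^bsub>smash p\<^esub> of_group_alg l"
    using c of_group_alg_closed by (simp add: A.minus_eq A.a_assoc A.l_neg)
  then have "H_proj p l ?c = H_proj p l ?r \<oplus>\<^bsub>H\<^esub> H_proj p l (of_group_alg l)"
    using ring_hom_add[OF H_proj_hom, of ?r "of_group_alg l"] r I.a_subset of_group_alg_closed
    by auto
  also have "H_proj p l ?r = \<zero>\<^bsub>H\<^esub>"
    using r by (simp add: H_proj_def H_alg_def FactRing_def I.a_rcos_const)
  finally show ?thesis
    by (simp add: carrier_H of_group_alg_closed)
qed

text \<open>Since \<open>g\<close> fixes \<open>x\<close>, powers of \<open>x\<close> commute with
  all of \<open>kG\<close> already in the smash product.\<close>

lemma of_group_alg_commute_x_power:
  "H_proj p l (of_group_alg l) \<otimes>\<^bsub>H\<^esub> \<phi> (fa_x ^ n)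
     = \<phi> (fa_x ^ n) \<otimes>\<^bsub>H\<^esub> H_proj p l (of_group_alg l)"
proof -
  have "of_group_alg l \<otimes>\<^bsub>smash p\<^esub> of_free_alg (fa_x ^ n)
      = of_free_alg (fa_x ^ n) \<otimes>\<^bsub>smash p\<^esub> of_group_alg l"
    by (simp add: of_free_alg_smash_mult smash_mult_of_free_alg of_group_alg_closed
        g_pow_fa_x_power) (simp add: of_group_alg_def single_0_commute)
  then show ?thesis
    using ring_hom_mult[OF H_proj_hom]
    by (simp add: of_free_alg_closed p_pos of_group_alg_closed flip: ring_hom_mult[OF H_proj_hom])
qed

lemma \<phi>_commutator_power:
  "\<phi> (fa_x ^ n * fa_y - fa_y * fa_x ^ n)
     = \<phi> (of_nat n * fa_x ^ (n - 1)) \<otimes>\<^bsub>H\<^esub> H_proj p l (of_group_alg l)"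
proof (induction n)
  case 0
  show ?case by (simp add: \<phi>_0 carrier_H of_group_alg_closed)
next
  case (Suc n)
  let ?L = "H_proj p l (of_group_alg l)"
  have L: "?L \<in> carrier H"
    by (simp add: carrier_H of_group_alg_closed)
  \<comment> \<open>The Leibniz rule for the commutator with \<open>y\<close>; afterwards \<lambda>
    is moved to the right of the powers of \<open>x\<close>.\<close>
  have "\<phi> (fa_x ^ Suc n * fa_y - fa_y * fa_x ^ Suc n)
      = \<phi> (fa_x * (fa_x ^ n * fa_y - fa_y * fa_x ^ n) + (fa_x * fa_y - fa_y * fa_x) * fa_x ^ n)"
    by (simp add: algebra_simps)
  also have "\<dots> = \<phi> (fa_x * (of_nat n * fa_x ^ (n - 1))) \<otimes>\<^bsub>H\<^esub> ?L \<oplus>\<^bsub>H\<^esub> \<phi> (fa_x ^ n) \<otimes>\<^bsub>H\<^esub> ?L"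
    by (simp only: \<phi>_add \<phi>_mult \<phi>_commutator Suc of_group_alg_commute_x_power
        H.m_assoc H.m_closed \<phi>_closed L)
  also have "\<dots> = \<phi> (fa_x * (of_nat n * fa_x ^ (n - 1)) + fa_x ^ n) \<otimes>\<^bsub>H\<^esub> ?L"
    by (simp only: \<phi>_add H.l_distr \<phi>_closed L)
  also have "fa_x * (of_nat n * fa_x ^ (n - 1)) + fa_x ^ n
      = (of_nat (Suc n) * fa_x ^ (Suc n - 1) :: 'k free_alg)"
    \<comment> \<open>For \<open>n = 0\<close> the truncated exponent \<open>n - 1\<close> is
      harmless, because its coefficient is zero.\<close>
    by (cases n) (simp_all add: algebra_simps mult_of_nat_commute)
  finally show ?case .
qed

text \<open>The elements \<open>f\<close> with this property form a subalgebra. Only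
  \<open>y\<close> needs an argument, where the commutator carries the factor
  \<open>p = 0\<close>.\<close>

lemma \<phi>_x_power_p_commute: "\<phi> (fa_x ^ p) \<otimes>\<^bsub>H\<^esub> \<phi> f = \<phi> f \<otimes>\<^bsub>H\<^esub> \<phi> (fa_x ^ p)"
proof (induction f rule: free_alg_induct)
  case (const c)
  show ?case by (simp add: single_0_commute flip: \<phi>_mult)
next
  case x
  show ?case by (simp add: power_commutes flip: \<phi>_mult)
next
  case y
  have "\<phi> (fa_x ^ p * fa_y - fa_y * fa_x ^ p) = \<zero>\<^bsub>H\<^esub>"
    using of_nat_CHAR_free_alg[where 'k = 'k]
    by (simp add: \<phi>_commutator_power \<phi>_0 CHAR_p carrier_H of_group_alg_closed)
  then show ?case
    using \<phi>_add[of "fa_x ^ p * fa_y - fa_y * fa_x ^ p" "fa_y * fa_x ^ p"]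
    by (simp add: \<phi>_closed flip: \<phi>_mult)
next
  case (add f h)
  then show ?case by (simp add: \<phi>_add \<phi>_closed H.l_distr H.r_distr)
next
  case (mult f h)
  then show ?case
    unfolding \<phi>_mult by (metis H.m_assoc \<phi>_closed)
qed

text \<open>An element of the free algebra fixed by \<open>g\<close> commutes with every
  \<open>g^k\<close>, so commuting with the free algebra suffices. The induction is on a bound
  \<open>k\<close> for the support of \<open>a\<close>, which is at most \<open>p\<close>.\<close>

lemma \<phi>_central:
  assumes g: "g_act c = c" and comm: "\<And>f. \<phi> c \<otimes>\<^bsub>H\<^esub> \<phi> f = \<phi> f \<otimes>\<^bsub>H\<^esub> \<phi> c"
    and h: "h \<in> carrier H"
  shows "\<phi> c \<otimes>\<^bsub>H\<^esub> h = h \<otimes>\<^bsub>H\<^esub> \<phi> c"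
proof -
  have g_pow: "(g_act ^^ n) c = c" for n
    by (induction n) (simp_all add: g)
  \<comment> \<open>\<open>?g k\<close> is the group element \<open>g^k\<close>.\<close>
  let ?g = "\<lambda>k n. if n = k then 1 else 0 :: 'k free_alg"
  have "\<phi> c \<otimes>\<^bsub>H\<^esub> H_proj p l a = H_proj p l a \<otimes>\<^bsub>H\<^esub> \<phi> c"
    if "k \<le> p" "\<forall>n\<ge>k. a n = 0" for a k
    using that
  proof (induction k arbitrary: a)
    case 0
    then have "a = of_free_alg 0" by (auto simp: of_free_alg_def)
    then show ?case by (simp add: comm)
  next
    case (Suc k)
    let ?b = "a(k := 0)"
    have gk: "?g k \<in> carrier (smash p)" and b: "?b \<in> carrier (smash p)"
      using Suc.prems by (auto simp: smash_def)
    have G: "H_proj p l (?g k) \<in> carrier H" and B: "H_proj p l ?b \<in> carrier H"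
      using gk b by (auto simp: carrier_H)
    have "of_free_alg c \<otimes>\<^bsub>smash p\<^esub> ?g k = ?g k \<otimes>\<^bsub>smash p\<^esub> of_free_alg c"
      using gk by (auto simp: of_free_alg_smash_mult smash_mult_of_free_alg g_pow)
    then have comm_g: "\<phi> c \<otimes>\<^bsub>H\<^esub> H_proj p l (?g k) = H_proj p l (?g k) \<otimes>\<^bsub>H\<^esub> \<phi> c"
      using gk by (simp add: of_free_alg_closed p_pos flip: ring_hom_mult[OF H_proj_hom])
    \<comment> \<open>The top term is split off; the rest has support below
      \<open>k\<close>.\<close>
    have "a = ?b \<oplus>\<^bsub>smash p\<^esub> of_free_alg (a k) \<otimes>\<^bsub>smash p\<^esub> ?g k"
      using gk by (auto simp: of_free_alg_smash_mult) (auto simp: smash_def)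
    then have a: "H_proj p l a = H_proj p l ?b \<oplus>\<^bsub>H\<^esub> \<phi> (a k) \<otimes>\<^bsub>H\<^esub> H_proj p l (?g k)"
      using gk b ring_hom_add[OF H_proj_hom b, of "of_free_alg (a k) \<otimes>\<^bsub>smash p\<^esub> ?g k"]
      by (simp add: of_free_alg_closed p_pos ring_hom_mult[OF H_proj_hom])
    have "\<phi> c \<otimes>\<^bsub>H\<^esub> (\<phi> (a k) \<otimes>\<^bsub>H\<^esub> H_proj p l (?g k))
        = \<phi> (a k) \<otimes>\<^bsub>H\<^esub> H_proj p l (?g k) \<otimes>\<^bsub>H\<^esub> \<phi> c"
      using G by (metis H.m_assoc \<phi>_closed comm comm_g)
    moreover have "\<phi> c \<otimes>\<^bsub>H\<^esub> H_proj p l ?b = H_proj p l ?b \<otimes>\<^bsub>H\<^esub> \<phi> c"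
      using Suc.prems by (intro Suc.IH) auto
    ultimately show ?case
      using G B by (simp add: a \<phi>_closed H.l_distr H.r_distr)
  qed
  moreover obtain a where "a \<in> carrier (smash p)" "h = H_proj p l a"
    using h by (auto simp: carrier_H)
  ultimately show ?thesis by (auto simp: smash_def)
qed

lemma \<phi>_const_central:
  "h \<in> carrier H \<Longrightarrow> \<phi> (Poly_Mapping.single 0 c) \<otimes>\<^bsub>H\<^esub> h = h \<otimes>\<^bsub>H\<^esub> \<phi> (Poly_Mapping.single 0 c)"
  by (rule \<phi>_central) (simp_all only: g_act_const single_0_commute flip: \<phi>_mult)

lemma \<phi>_x_power_p_minus_const_central:
  assumes "h \<in> carrier H"
  shows "\<phi> (fa_x ^ p - Poly_Mapping.single 0 c) \<otimes>\<^bsub>H\<^esub> h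
       = h \<otimes>\<^bsub>H\<^esub> \<phi> (fa_x ^ p - Poly_Mapping.single 0 c)"
proof -
  \<comment> \<open>Subtraction is turned into addition of a negative constant so that
    \<open>\<phi>_add\<close> applies.\<close>
  have eq: "fa_x ^ p - Poly_Mapping.single 0 c = fa_x ^ p + Poly_Mapping.single 0 (- c)"
    by (simp add: single_uminus)
  have "\<phi> (fa_x ^ p) \<otimes>\<^bsub>H\<^esub> h = h \<otimes>\<^bsub>H\<^esub> \<phi> (fa_x ^ p)"
    using g_pow_fa_x_power[of 1 p] \<phi>_central[OF _ \<phi>_x_power_p_commute assms] by simp
  then show ?thesis
    unfolding eq using \<phi>_const_central[OF assms, of "- c"] assms
    by (simp only: \<phi>_add \<phi>_closed H.l_distr H.r_distr)
qed

end

text \<open>The cofactor stands on the left because a Verma module is a quotient by a left ideal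
  containing \<open>x - \<alpha>\<close>.\<close>

lemma x_minus_const_dvd_x_power_minus:
  "\<exists>w. fa_x ^ n - Poly_Mapping.single 0 (\<alpha> ^ n)
     = w * (fa_x - Poly_Mapping.single 0 \<alpha> :: 'k::field free_alg)"
proof (induction n)
  case 0
  show ?case by (auto intro: exI[of _ 0])
next
  case (Suc n)
  then obtain w where w: "fa_x ^ n - Poly_Mapping.single 0 (\<alpha> ^ n)
     = w * (fa_x - Poly_Mapping.single 0 \<alpha>)" by blast
  let ?a = "Poly_Mapping.single 0 \<alpha> :: 'k free_alg"
  have "fa_x ^ Suc n - Poly_Mapping.single 0 (\<alpha> ^ Suc n)
      = fa_x ^ n * (fa_x - ?a) + ?a * (fa_x ^ n - Poly_Mapping.single 0 (\<alpha> ^ n))"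
    using single_0_commute[of "fa_x ^ n" \<alpha>]
    by (simp add: algebra_simps mult_single power_commutes)
  also have "\<dots> = (fa_x ^ n + ?a * w) * (fa_x - ?a)"
    by (simp add: w algebra_simps)
  finally show ?case by blast
qed

section \<open>Verma modules\<close>

context char_p_smash
begin

lemma g_minus_one_closed: "H_proj p l smash_g \<ominus>\<^bsub>H\<^esub> \<one>\<^bsub>H\<^esub> \<in> carrier H"
proof -
  have "smash_g \<in> carrier (smash p)"
    using prime_gt_1_nat[OF prime_p] by (auto simp: smash_g_def smash_def)
  then have "H_proj p l smash_g \<in> carrier H"
    unfolding carrier_H by (rule imageI)
  then show ?thesis by simp
qed

lemma verma_left_ideal:
  "additive_subgroup {a \<otimes>\<^bsub>H\<^esub> \<phi> (fa_x - Poly_Mapping.single 0 \<alpha>)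
       \<oplus>\<^bsub>H\<^esub> b \<otimes>\<^bsub>H\<^esub> (H_proj p l smash_g \<ominus>\<^bsub>H\<^esub> \<one>\<^bsub>H\<^esub>) | a b. a \<in> carrier H \<and> b \<in> carrier H}
     (regular_module H)"
  using H.additive_subgroup_left_ideal_pair[OF \<phi>_closed g_minus_one_closed]
  by (simp add: additive_subgroup_def regular_module_def subgroup_def m_inv_def)

lemma abelian_group_verma: "abelian_group (verma p l \<alpha>)"
  unfolding verma_def Let_def
  by (intro abelian_group_quotient_module abelian_group_regular_module H.ring_axioms
      verma_left_ideal)

text \<open>That the element lies in the left ideal settles only its action on the generator.
  Centrality extends this to every coset: \<open>z h = h z = (h w) (x - \<alpha>)\<close>.\<close>

lemma verma_annihilated:
  assumes "C \<in> carrier (verma p l \<alpha>)"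
  shows "\<phi> (fa_x ^ p - Poly_Mapping.single 0 (\<alpha> ^ p)) \<odot>\<^bsub>verma p l \<alpha>\<^esub> C = \<zero>\<^bsub>verma p l \<alpha>\<^esub>"
proof -
  let ?z = "\<phi> (fa_x ^ p - Poly_Mapping.single 0 (\<alpha> ^ p))"
  let ?u = "\<phi> (fa_x - Poly_Mapping.single 0 \<alpha>)"
  let ?v = "H_proj p l smash_g \<ominus>\<^bsub>H\<^esub> \<one>\<^bsub>H\<^esub>"
  obtain w where w: "fa_x ^ p - Poly_Mapping.single 0 (\<alpha> ^ p)
      = w * (fa_x - Poly_Mapping.single 0 \<alpha> :: 'k free_alg)"
    using x_minus_const_dvd_x_power_minus by blast
  have "?z \<otimes>\<^bsub>H\<^esub> h \<in> {a \<otimes>\<^bsub>H\<^esub> ?u \<oplus>\<^bsub>H\<^esub> b \<otimes>\<^bsub>H\<^esub> ?v | a b. a \<in> carrier H \<and> b \<in> carrier H}"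
    if h: "h \<in> carrier H" for h
  proof -
    have "?z \<otimes>\<^bsub>H\<^esub> h = h \<otimes>\<^bsub>H\<^esub> ?z"
      using h by (rule \<phi>_x_power_p_minus_const_central)
    also have "\<dots> = (h \<otimes>\<^bsub>H\<^esub> \<phi> w) \<otimes>\<^bsub>H\<^esub> ?u \<oplus>\<^bsub>H\<^esub> \<zero>\<^bsub>H\<^esub> \<otimes>\<^bsub>H\<^esub> ?v"
      using h g_minus_one_closed by (simp add: w \<phi>_mult \<phi>_closed H.m_assoc)
    finally show ?thesis
      using h \<phi>_closed H.m_closed H.zero_closed by blast
  qed
  then show ?thesis
    using assms unfolding verma_def Let_def
    by (intro quotient_module_annihilated abelian_group_regular_module H.ring_axioms
        verma_left_ideal) (simp_all add: regular_module_def)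
qed

end

text \<open>The freshman's dream for \<open>a = (a - b) + b\<close> turns equality of the powers
  into the vanishing of a power of \<open>a - b\<close>.\<close>

lemma power_CHAR_eq_iff:
  fixes a b :: "'a::idom"
  assumes "prime CHAR('a)"
  shows "a ^ CHAR('a) = b ^ CHAR('a) \<longleftrightarrow> a = b"
proof
  assume "a ^ CHAR('a) = b ^ CHAR('a)"
  moreover have "a ^ CHAR('a) = (a - b) ^ CHAR('a) + b ^ CHAR('a)"
    using freshmans_dream[OF assms refl, of "a - b" b] by simp
  ultimately show "a = b" by simp
qed simp

theorem proposition5p25:
  fixes p :: nat
    and l :: "nat \<Rightarrow> 'k::alg_closed_field"
    and \<alpha> \<alpha>' :: 'k
    and S :: "('k H_elem, 's) module"
    and S' :: "('k H_elem, 't) module"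
    and P :: "nat \<Rightarrow> ('k H_elem, 'c) module"
    and d :: "nat \<Rightarrow> 'c \<Rightarrow> 'c"
    and \<epsilon> :: "'c \<Rightarrow> 's"
    and i :: nat
  assumes "prime p" and "odd p" and "CHAR('k) = p"
    and "l \<in> group_alg p" and "l \<noteq> (\<lambda>_. 0)" and "l 0 = 0"
    and "\<alpha> \<noteq> \<alpha>'"
    and "simple_module (H_alg p l) S" and "is_subquotient (H_alg p l) S (verma p l \<alpha>)"
    and "simple_module (H_alg p l) S'" and "is_subquotient (H_alg p l) S' (verma p l \<alpha>')"
    and "projective_resolution (H_alg p l) S P d \<epsilon>"
  shows "trivial_group (Ext_group (H_alg p l) P d S' i)"
proof -
  interpret char_p_smash p l
    by standard fact+
  interpret S': left_module H S'
    using assms(10) by (simp add: simple_module_def)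
  let ?z = "\<lambda>\<alpha>. \<phi> (fa_x ^ p - Poly_Mapping.single 0 (\<alpha> ^ p))"
  \<comment> \<open>The scalar by which \<open>?z \<alpha>\<close> acts on
    \<open>S'\<close>.\<close>
  define \<delta> where "\<delta> = \<alpha>' ^ p - \<alpha> ^ p"
  let ?w = "\<phi> (Poly_Mapping.single 0 (inverse \<delta>))"
  have "\<delta> \<noteq> 0"
    using assms(1,3,7) power_CHAR_eq_iff[of \<alpha>' \<alpha>] by (auto simp: \<delta>_def)
  have annS: "?z \<alpha> \<odot>\<^bsub>S\<^esub> x = \<zero>\<^bsub>S\<^esub>" if "x \<in> carrier S" for x
    using assms(8,9) that
    by (intro is_subquotient_annihilated[OF _ _ abelian_group_verma \<phi>_closed verma_annihilated])
       (auto simp: simple_module_def)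
  have annS': "?z \<alpha>' \<odot>\<^bsub>S'\<^esub> y = \<zero>\<^bsub>S'\<^esub>" if "y \<in> carrier S'" for y
    using assms(10,11) that
    by (intro is_subquotient_annihilated[OF _ _ abelian_group_verma \<phi>_closed verma_annihilated])
       (auto simp: simple_module_def)
  have unit: "?w \<odot>\<^bsub>S'\<^esub> (?z \<alpha> \<odot>\<^bsub>S'\<^esub> y) = y" if y: "y \<in> carrier S'" for y
  proof -
    \<comment> \<open>\<open>?z \<alpha>\<close> differs from \<open>?z \<alpha>'\<close>, which
      kills \<open>S'\<close>, by the constant \<open>\<delta>\<close>.\<close>
    have "fa_x ^ p - Poly_Mapping.single 0 (\<alpha> ^ p)
        = fa_x ^ p - Poly_Mapping.single 0 (\<alpha>' ^ p) + Poly_Mapping.single 0 \<delta>"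
      by (simp add: \<delta>_def single_diff)
    then have "?z \<alpha> = ?z \<alpha>' \<oplus>\<^bsub>H\<^esub> \<phi> (Poly_Mapping.single 0 \<delta>)"
      by (simp only: \<phi>_add)
    then have "?z \<alpha> \<odot>\<^bsub>S'\<^esub> y = \<phi> (Poly_Mapping.single 0 \<delta>) \<odot>\<^bsub>S'\<^esub> y"
      using y annS' by (simp add: \<phi>_closed S'.smult_l_distr S'.smult_closed)
    then have "?w \<odot>\<^bsub>S'\<^esub> (?z \<alpha> \<odot>\<^bsub>S'\<^esub> y)
        = \<phi> (Poly_Mapping.single 0 (inverse \<delta>) * Poly_Mapping.single 0 \<delta>) \<odot>\<^bsub>S'\<^esub> y"
      using y by (simp add: \<phi>_mult \<phi>_closed S'.smult_assoc)
    also have "\<dots> = y"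
      using \<open>\<delta> \<noteq> 0\<close> y by (simp add: mult_single \<phi>_1 S'.smult_one)
    finally show ?thesis .
  qed
  \<comment> \<open>Elements of \<open>H\<close> are sets, so \<open>empty_not_UNIV\<close> supplies
    the two distinct elements of the scalar type.\<close>
  show ?thesis
    using assms(12) S'.left_module_axioms \<phi>_closed \<phi>_x_power_p_minus_const_central
      \<phi>_closed \<phi>_const_central annS unit empty_not_UNIV
    by (rule Ext_group_trivial_if_central_separates)
qed

end
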